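(* Let $K$ be a global field, let $E\in K[x,y]$ be a nonzero homogeneous polynomial of positive degree, and let $S=\{\phi_1,\phi_2,\dots,\phi_s\}$ be a finite set of endomorphisms (over $K$) of $\mathbb{P}^1$, all of degree at least $2$. Let $\nu_1$ be a probability measure on $S$ and $\nu$ the induced product probability measure on $\Phi_S$. Fix lifts $\tilde{\phi}_i:\mathbb{A}^2\rightarrow\mathbb{A}^2$ over $K$ for each $\phi_i$, and extend these to lifts $\tilde\gamma$ of each element $\gamma\in\Phi_S$. Then: (1) For all $v\in M_K$, the local expected canonical height $$\mathbb{E}_\nu\big[\hat{\lambda}_{v,\tilde{\gamma},E}\big](P):=\int_{\Phi_S}\hat{\lambda}_{v,\tilde\gamma,E}(P)\,d\nu(\gamma)$$ is well defined for all $P\in\mathbb{P}^1(K_v)\setminus\{E=0\}$. (2) For all $P\in\mathbb{P}^1(K)\setminus\{E=0\}$, $$\mathbb{E}_\nu\big[\hat{h}\big](P)=\frac{1}{\deg(E)}\sum_{v\in M_K}n_v\,\mathbb{E}_\nu\big[\hat{\lambda}_{v,\tilde{\gamma},E}\big](P).$$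
   Context: Places: $M_K$ is a complete set of absolute values $|\cdot|_v$ on $K$, $K_v$ is the completion, and $n_v$ is the local degree, normalized so that the product formula $\sum_{v}n_v\log|c|_v=0$ ($c\in K^*$) holds and the Weil height on $\mathbb{P}^1(K)$ is $h([x,y])=\sum_{v\in M_K}n_v\log\lVert(x,y)\rVert_v$, where $\lVert(x,y)\rVert_v=\max\{|x|_v,|y|_v\}$. Lifts and sequences: a lift of $\phi$ of degree $d$ is a pair of homogeneous polynomials of degree $d$ over $K$ with no common factor inducing $\phi$ on $\mathbb{P}^1$. $\Phi_S=\prod_{i=1}^\infty S$. For $\gamma=(\theta_n)_{n\ge1}\in\Phi_S$, $\gamma_n\cdot P=(\theta_n\circ\cdots\circ\theta_1)(P)$, $\tilde\gamma=(\tilde\theta_n)_{n\ge1}$, $\tilde\gamma_n=\tilde\theta_n\circ\cdots\circ\tilde\theta_1$, and $\deg(\gamma_n)=\deg(\tilde\gamma_n)=\prod_{i=1}^n\deg(\theta_i)$. Heights: $\hat h_\gamma(P)=\lim_{n\to\infty}h(\gamma_n\cdot P)/\deg(\gamma_n)$ and $\mathbb{E}_\nu[\hat h](P)=\int_{\Phi_S}\hat h_\gamma(P)\,d\nu(\gamma)$. Green function: for $(x,y)\in\mathbb{A}^2(K_v)\setminus\{(0,0)\}$, $\mathcal{G}_{v,\tilde{\gamma}}(x,y)=\lim_{n\to\infty}\log\lVert\tilde{\gamma}_n(x,y)\rVert_v/\deg(\tilde{\gamma}_n)$. Local canonical height: $\hat{\lambda}_{v,\tilde{\gamma},E}([x,y]):=\deg(E)\,\mathcal{G}_{v,\tilde{\gamma}}(x,y)-\log|E(x,y)|_v$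 for $[x,y]\in\mathbb{P}^1(K_v)$ with $E(x,y)\neq0$. These limits exist, and $\hat\lambda_{v,\tilde\gamma,E}$ does not depend on the choice of homogeneous coordinates. *)

theory Defs
  imports
    "HOL-Probability.Probability"
    "HOL-Algebra.Algebraic_Closure_Type"
    "HOL-Algebra.Generated_Fields"
    "HOL-Algebra.QuotRing"
begin

(* The global field K is the universe of a type 'a :: field.  It is regarded as a HOL-Algebra ring
   where this lets one definition serve both K and its completions, which are rings of classes of
   Cauchy sequences over 'a. *)
abbreviation global_ring :: "'a::field ring" where
  "global_ring \<equiv> ring_of_type_algebra"

section \<open>Global fields, places, completions and local degrees\<close>

definition prime_subfield :: "'a::field set" where
  "prime_subfield = generate_field global_ring {}"

(* F is the base field of K: the rationals, or a rational function field F_p(t). *)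
definition global_field_over :: "'a::field set \<Rightarrow> bool" where
  "global_field_over F \<longleftrightarrow>
     ring.finite_dimension global_ring F (UNIV :: 'a set) \<and>
     (if CHAR('a) = 0 then F = prime_subfield
      else \<exists>t. ring.transcendental global_ring prime_subfield t \<and>
               F = generate_field global_ring {t})"

definition absolute_value :: "('a::field \<Rightarrow> real) \<Rightarrow> bool" where
  "absolute_value v \<longleftrightarrow>
     (\<forall>x. 0 \<le> v x) \<and> (\<forall>x. v x = 0 \<longleftrightarrow> x = 0) \<and>
     (\<forall>x y. v (x * y) = v x * v y) \<and> (\<forall>x y. v (x + y) \<le> v x + v y)"

(* An absolute value is determined on the rationals by its values on the integers. *)
definition standard_on_rationals :: "('a::field \<Rightarrow> real) \<Rightarrow> bool" where
  "standard_on_rationals v \<longleftrightarrow>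
     (\<forall>m::int. v (of_int m) = \<bar>of_int m\<bar>) \<or>
     (\<exists>p::nat. Factorial_Ring.prime p \<and>
        (\<forall>m::int. m \<noteq> 0 \<longrightarrow> v (of_int m) = (1 / real p) ^ multiplicity (int p) m))"

definition prime_polys :: "'a::field poly set" where
  "prime_polys = {f. \<forall>i. poly.coeff f i \<in> prime_subfield}"

definition prime_irreducible :: "'a::field poly \<Rightarrow> bool" where
  "prime_irreducible q \<longleftrightarrow>
     q \<in> prime_polys \<and> Polynomial.degree q > 0 \<and>
     (\<forall>a\<in>prime_polys. \<forall>b\<in>prime_polys. q = a * b \<longrightarrow>
        Polynomial.degree a = 0 \<or> Polynomial.degree b = 0)"

(* The absolute values of F_p(t), determined by their values on F_p[t]: the one at infinity,
   |f| = p^(deg f), and for each irreducible q in F_p[t] the one with |q| = p^(-deg q).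
   The multiplicity of q in f is the same in K[X] as in F_p[X]. *)
definition standard_on_rational_functions :: "'a::field \<Rightarrow> ('a \<Rightarrow> real) \<Rightarrow> bool" where
  "standard_on_rational_functions t v \<longleftrightarrow>
     (\<forall>f\<in>prime_polys. f \<noteq> 0 \<longrightarrow> v (poly f t) = real CHAR('a) ^ Polynomial.degree f) \<or>
     (\<exists>q. prime_irreducible q \<and>
        (\<forall>f\<in>prime_polys. f \<noteq> 0 \<longrightarrow>
           v (poly f t) = (1 / real CHAR('a)) ^ (Polynomial.degree q * (GREATEST k. q ^ k dvd f))))"

(* M_K: the absolute values of K that restrict to a standard one on F.  Every standard absolute
   value of F_p(t) takes a uniformizer to 1/(size of the residue field), so the choice of the
   generator t of F is immaterial. *)
definition places :: "'a::field set \<Rightarrow> ('a \<Rightarrow> real) set" where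
  "places F = {v. absolute_value v \<and>
     (if CHAR('a) = 0 then standard_on_rationals v
      else \<exists>t. ring.transcendental global_ring prime_subfield t \<and>
               F = generate_field global_ring {t} \<and> standard_on_rational_functions t v)}"

definition cauchy_seqs :: "('a::field \<Rightarrow> real) \<Rightarrow> (nat \<Rightarrow> 'a) set" where
  "cauchy_seqs v = {u. \<forall>e>0. \<exists>N. \<forall>m\<ge>N. \<forall>n\<ge>N. v (u m - u n) < e}"

definition null_seqs :: "('a::field \<Rightarrow> real) \<Rightarrow> (nat \<Rightarrow> 'a) set" where
  "null_seqs v = {u. (\<lambda>n. v (u n)) \<longlonglongrightarrow> 0}"

definition cauchy_ring :: "('a::field \<Rightarrow> real) \<Rightarrow> (nat \<Rightarrow> 'a) ring" where
  "cauchy_ring v =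
     \<lparr>carrier = cauchy_seqs v, monoid.mult = (\<lambda>u w n. u n * w n), one = (\<lambda>n. 1),
      ring.zero = (\<lambda>n. 0), add = (\<lambda>u w n. u n + w n)\<rparr>"

definition completion_ring :: "('a::field \<Rightarrow> real) \<Rightarrow> (nat \<Rightarrow> 'a) set ring" where
  "completion_ring v = cauchy_ring v Quot null_seqs v"

definition seq_class :: "('a::field \<Rightarrow> real) \<Rightarrow> (nat \<Rightarrow> 'a) \<Rightarrow> (nat \<Rightarrow> 'a) set" where
  "seq_class v u = null_seqs v +>\<^bsub>cauchy_ring v\<^esub> u"

definition completion_embed :: "('a::field \<Rightarrow> real) \<Rightarrow> 'a \<Rightarrow> (nat \<Rightarrow> 'a) set" where
  "completion_embed v c = seq_class v (\<lambda>n. c)"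

(* The extension of v to the completion: the limit of v along any representing sequence. *)
definition completion_abs :: "('a::field \<Rightarrow> real) \<Rightarrow> (nat \<Rightarrow> 'a) set \<Rightarrow> real" where
  "completion_abs v \<xi> = lim (\<lambda>n. v ((SOME u. u \<in> \<xi>) n))"

(* The completion F_v of the base field, as a subfield of K_v. *)
definition base_completion :: "'a::field set \<Rightarrow> ('a \<Rightarrow> real) \<Rightarrow> (nat \<Rightarrow> 'a) set set" where
  "base_completion F v = seq_class v ` {u \<in> cauchy_seqs v. range u \<subseteq> F}"

(* n_v = [K_v : F_v] / [K : F], which is the normalization giving the absolute Weil height. *)
definition local_degree :: "'a::field set \<Rightarrow> ('a \<Rightarrow> real) \<Rightarrow> real" where
  "local_degree F v =
     real (ring.dim (completion_ring v) (base_completion F v) (carrier (completion_ring v))) /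
     real (ring.dim global_ring F (UNIV :: 'a set))"

definition product_formula :: "'a::field set \<Rightarrow> bool" where
  "product_formula F \<longleftrightarrow>
     (\<forall>c. c \<noteq> 0 \<longrightarrow> ((\<lambda>v. local_degree F v * ln (v c)) has_sum 0) (places F))"

section \<open>The projective line and its endomorphisms\<close>

definition proj_point :: "('r, 'm) ring_scheme \<Rightarrow> 'r \<times> 'r \<Rightarrow> ('r \<times> 'r) set" where
  "proj_point R p =
     {(c \<otimes>\<^bsub>R\<^esub> fst p, c \<otimes>\<^bsub>R\<^esub> snd p) | c. c \<in> carrier R - {\<zero>\<^bsub>R\<^esub>}}"

definition affine_minus_origin :: "('r, 'm) ring_scheme \<Rightarrow> ('r \<times> 'r) set" where
  "affine_minus_origin R = carrier R \<times> carrier R - {(\<zero>\<^bsub>R\<^esub>, \<zero>\<^bsub>R\<^esub>)}"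

definition proj_line :: "('r, 'm) ring_scheme \<Rightarrow> ('r \<times> 'r) set set" where
  "proj_line R = proj_point R ` affine_minus_origin R"

definition coords :: "('r \<times> 'r) set \<Rightarrow> 'r \<times> 'r" where
  "coords P = (SOME p. p \<in> P)"

definition proj_embed ::
  "('a::field \<Rightarrow> real) \<Rightarrow> ('a \<times> 'a) set \<Rightarrow> ((nat \<Rightarrow> 'a) set \<times> (nat \<Rightarrow> 'a) set) set" where
  "proj_embed v P = proj_point (completion_ring v) (map_prod (completion_embed v) (completion_embed v) (coords P))"

(* K[x,y] is rendered as 'a poly poly: the coefficient of x^i y^j in F is
   poly.coeff (poly.coeff F i) j. *)
type_synonym 'a bipoly = "'a poly poly"

definition bisupport :: "'a::zero bipoly \<Rightarrow> (nat \<times> nat) set" where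
  "bisupport F = {(i, j). poly.coeff (poly.coeff F i) j \<noteq> 0}"

definition homogeneous :: "nat \<Rightarrow> 'a::zero bipoly \<Rightarrow> bool" where
  "homogeneous d F \<longleftrightarrow> (\<forall>(i, j)\<in>bisupport F. i + j = d)"

definition total_degree :: "'a::zero bipoly \<Rightarrow> nat" where
  "total_degree F = Max (insert 0 ((\<lambda>(i, j). i + j) ` bisupport F))"

(* Evaluation at a point of R x R, the coefficients being carried into R by \<iota>. *)
definition bieval ::
  "('r, 'm) ring_scheme \<Rightarrow> ('a::zero \<Rightarrow> 'r) \<Rightarrow> 'a bipoly \<Rightarrow> 'r \<times> 'r \<Rightarrow> 'r" where
  "bieval R \<iota> F p =
     (\<Oplus>\<^bsub>R\<^esub>k\<in>bisupport F. \<iota> (poly.coeff (poly.coeff F (fst k)) (snd k)) \<otimes>\<^bsub>R\<^esub>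
        (fst p [^]\<^bsub>R\<^esub> fst k \<otimes>\<^bsub>R\<^esub> snd p [^]\<^bsub>R\<^esub> snd k))"

definition lift_map ::
  "('r, 'm) ring_scheme \<Rightarrow> ('a::zero \<Rightarrow> 'r) \<Rightarrow> 'a bipoly \<times> 'a bipoly \<Rightarrow> 'r \<times> 'r \<Rightarrow> 'r \<times> 'r" where
  "lift_map R \<iota> L p = (bieval R \<iota> (fst L) p, bieval R \<iota> (snd L) p)"

definition zero_locus ::
  "('r, 'm) ring_scheme \<Rightarrow> ('a::zero \<Rightarrow> 'r) \<Rightarrow> 'a bipoly \<Rightarrow> ('r \<times> 'r) set set" where
  "zero_locus R \<iota> E = {P \<in> proj_line R. \<forall>p\<in>P. bieval R \<iota> E p = \<zero>\<^bsub>R\<^esub>}"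

(* A morphism over K is identified with the map it induces on P^1(K), which determines it because
   K is infinite. *)
type_synonym 'a proj_map = "('a \<times> 'a) set \<Rightarrow> ('a \<times> 'a) set"

definition is_lift :: "nat \<Rightarrow> 'a::field bipoly \<times> 'a bipoly \<Rightarrow> 'a proj_map \<Rightarrow> bool" where
  "is_lift d L \<phi> \<longleftrightarrow>
     homogeneous d (fst L) \<and> homogeneous d (snd L) \<and> coprime (fst L) (snd L) \<and>
     (\<forall>p\<in>affine_minus_origin global_ring.
        \<phi> (proj_point global_ring p) = proj_point global_ring (lift_map global_ring id L p))"

definition endomorphism :: "'a::field proj_map \<Rightarrow> bool" where
  "endomorphism \<phi> \<longleftrightarrow>
     \<phi> \<in> extensional (proj_line global_ring) \<and> (\<exists>d L. is_lift d L \<phi>)"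

definition endo_degree :: "'a::field proj_map \<Rightarrow> nat" where
  "endo_degree \<phi> = (THE d. \<exists>L. is_lift d L \<phi>)"

section \<open>Random iteration, heights and Green functions\<close>

(* A sequence \<gamma> has entries \<gamma> 1, \<gamma> 2, ...; compose_upto T n = T n o ... o T 1. *)
primrec compose_upto :: "(nat \<Rightarrow> 'b \<Rightarrow> 'b) \<Rightarrow> nat \<Rightarrow> 'b \<Rightarrow> 'b" where
  "compose_upto T 0 = id"
| "compose_upto T (Suc n) = T (Suc n) \<circ> compose_upto T n"

definition iter_degree :: "(nat \<Rightarrow> 'a::field proj_map) \<Rightarrow> nat \<Rightarrow> nat" where
  "iter_degree \<gamma> n = (\<Prod>i\<in>{1..n}. endo_degree (\<gamma> i))"

definition sequence_measure :: "'b measure \<Rightarrow> (nat \<Rightarrow> 'b) measure" where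
  "sequence_measure \<nu>\<^sub>1 = (\<Pi>\<^sub>M i\<in>{1..}. \<nu>\<^sub>1)"

definition weil_height :: "'a::field set \<Rightarrow> ('a \<times> 'a) set \<Rightarrow> real" where
  "weil_height F P =
     (\<Sum>\<^sub>\<infinity>v\<in>places F. local_degree F v * ln (max (v (fst (coords P))) (v (snd (coords P)))))"

definition canonical_height ::
  "'a::field set \<Rightarrow> (nat \<Rightarrow> 'a proj_map) \<Rightarrow> ('a \<times> 'a) set \<Rightarrow> real" where
  "canonical_height F \<gamma> P =
     lim (\<lambda>n. weil_height F (compose_upto \<gamma> n P) / real (iter_degree \<gamma> n))"

definition local_norm ::
  "('a::field \<Rightarrow> real) \<Rightarrow> (nat \<Rightarrow> 'a) set \<times> (nat \<Rightarrow> 'a) set \<Rightarrow> real" where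
  "local_norm v p = max (completion_abs v (fst p)) (completion_abs v (snd p))"

(* lft chooses a lift of every map; the lift of \<gamma> is the sequence lft (\<gamma> 1), lft (\<gamma> 2), ... *)
definition green ::
  "('a::field \<Rightarrow> real) \<Rightarrow> ('a proj_map \<Rightarrow> 'a bipoly \<times> 'a bipoly) \<Rightarrow> (nat \<Rightarrow> 'a proj_map) \<Rightarrow>
     (nat \<Rightarrow> 'a) set \<times> (nat \<Rightarrow> 'a) set \<Rightarrow> real" where
  "green v lft \<gamma> p =
     lim (\<lambda>n. ln (local_norm v
                (compose_upto (\<lambda>i. lift_map (completion_ring v) (completion_embed v) (lft (\<gamma> i))) n p)) /
              real (iter_degree \<gamma> n))"

definition local_height ::
  "('a::field \<Rightarrow> real) \<Rightarrow> ('a proj_map \<Rightarrow> 'a bipoly \<times> 'a bipoly) \<Rightarrow> (nat \<Rightarrow> 'a proj_map) \<Rightarrow>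
     'a bipoly \<Rightarrow> ((nat \<Rightarrow> 'a) set \<times> (nat \<Rightarrow> 'a) set) set \<Rightarrow> real" where
  "local_height v lft \<gamma> E P =
     real (total_degree E) * green v lft \<gamma> (coords P) -
     ln (completion_abs v (bieval (completion_ring v) (completion_embed v) E (coords P)))"

definition expected_canonical_height ::
  "'a::field set \<Rightarrow> 'a proj_map measure \<Rightarrow> ('a \<times> 'a) set \<Rightarrow> real" where
  "expected_canonical_height F \<nu>\<^sub>1 P =
     (\<integral>\<gamma>. canonical_height F \<gamma> P \<partial>sequence_measure \<nu>\<^sub>1)"

definition expected_local_height ::
  "'a::field proj_map measure \<Rightarrow> ('a \<Rightarrow> real) \<Rightarrow> ('a proj_map \<Rightarrow> 'a bipoly \<times> 'a bipoly) \<Rightarrow>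
     'a bipoly \<Rightarrow> ((nat \<Rightarrow> 'a) set \<times> (nat \<Rightarrow> 'a) set) set \<Rightarrow> real" where
  "expected_local_height \<nu>\<^sub>1 v lft E P =
     (\<integral>\<gamma>. local_height v lft \<gamma> E P \<partial>sequence_measure \<nu>\<^sub>1)"

end

theory Submission
  imports Defs
begin

text \<open>For a lift of degree $d$ there are constants $C_v$ with
  $\exp(-C_v)\,\|p\|_v^d \le \|\Phi(p)\|_v \le \exp(C_v)\,\|p\|_v^d$ at every place: Bezout identities for the
  two dehomogenizations give the lower bound. The $C_v$ are built from terms $|\log|c|_v|$ with $c$ in $K$, so
  the product formula, read as absolute convergence, already gives $\sum_v n_v C_v < \infty$; finiteness of
  the set of bad places is never needed. The inequality passes to the completions by taking limits along Cauchy
  sequences. Hence the normalized logarithms of the iterates converge to the Green function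
  with error at most $C_v/2^n$, uniformly in $\gamma$. Since these errors are summable over $v$, the canonical height
  is the sum of the Green functions, and the same domination allows integration over $\gamma$ term by
  term. The contribution of $E$ and the change of coordinates vanish by the product formula.\<close>

section \<open>Binary forms and their dehomogenizations\<close>

text \<open>\<open>ln\<close>, \<open>lim\<close>, infinite sums and integrals denote something even
  where the mathematical object does not exist, so an equation between heights has content only
  together with existence; hence most results are stated with \<open>has_sum\<close>, limits or
  \<open>integrable\<close>. The default \<open>ln 0 = 0\<close> is used throughout: |log|c|_v| is
  then summable for every c in K, 0 included, and vanishing coefficients or coordinates need no
  separate estimate. One estimate serves both convergence over v and integration over \<gamma>:
  |G_v(x,y)| is at most |log|x|_v| + |log|y|_v| + C_v. Points are sets and \<open>coords\<close>
  picks an arbitrary representative, so two rescalings occur, and they disappear for different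
  reasons. Over K the scalar lies in K, and the product formula removes it from the Weil height.
  Over K_v the scalar lies in K_v and changes with v, out of reach of the product formula; it
  cancels inside the local height, because deg(E) G and log|E| both grow by deg(E) log|c|.\<close>

lemma poly_bezout:
  fixes f g :: "'a::field poly"
  assumes "coprime f g"
  shows "\<exists>a b. a * f + b * g = 1"
proof -
  \<comment> \<open>I is the ideal (f, g). By division with remainder, a nonzero element of least
    degree divides every element, in particular f and g, so coprimality makes it a unit.\<close>
  define I where "I = {a * f + b * g | a b. True}"
  have "f \<noteq> 0 \<or> g \<noteq> 0"
    using assms by auto
  moreover have "f \<in> I"
    unfolding I_def by (rule CollectI, rule exI[of _ 1], rule exI[of _ 0]) simp
  moreover have "g \<in> I"
    unfolding I_def by (rule CollectI, rule exI[of _ 0], rule exI[of _ 1]) simp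
  ultimately have "\<exists>h. h \<in> I \<and> h \<noteq> 0"
    by blast
  then obtain h where h: "h \<in> I" "h \<noteq> 0"
    and least: "\<And>k. k \<in> I \<Longrightarrow> k \<noteq> 0 \<Longrightarrow> Polynomial.degree h \<le> Polynomial.degree k"
    using ex_has_least_nat[of "\<lambda>h. h \<in> I \<and> h \<noteq> 0" _ Polynomial.degree] by blast
  obtain a b where ab: "h = a * f + b * g"
    using h(1) unfolding I_def by (elim CollectE exE conjE)
  have dvd: "h dvd k" if "k \<in> I" for k
  proof -
    obtain a' b' where k: "k = a' * f + b' * g"
      using \<open>k \<in> I\<close> unfolding I_def by (elim CollectE exE conjE)
    have "k mod h = k - (k div h) * h"
      by (simp add: minus_div_mult_eq_mod)
    also have "\<dots> = (a' - (k div h) * a) * f + (b' - (k div h) * b) * g"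
      by (subst ab, subst k) (simp add: algebra_simps)
    finally have "k mod h \<in> I"
      unfolding I_def by blast
    moreover have "k mod h = 0 \<or> Polynomial.degree (k mod h) < Polynomial.degree h"
      using degree_mod_less[of h k] h(2) by auto
    ultimately have "k mod h = 0"
      using least[of "k mod h"] by force
    then show ?thesis
      by auto
  qed
  have "is_unit h"
    using assms dvd[OF \<open>f \<in> I\<close>] dvd[OF \<open>g \<in> I\<close>] by (rule coprime_common_divisor)
  then obtain u where "1 = h * u"
    by (rule dvdE)
  then have "(u * a) * f + (u * b) * g = 1"
    by (simp add: ab algebra_simps)
  then show ?thesis
    by blast
qed

text \<open>The form $V^e h(U/V)$; the two charts of the projective line correspond to the two orders of
  the variables.\<close>
definition homogenize :: "'a::field bipoly \<Rightarrow> 'a bipoly \<Rightarrow> nat \<Rightarrow> 'a poly \<Rightarrow> 'a bipoly" where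
  "homogenize U V e h = (\<Sum>i\<le>e. [:[:poly.coeff h i:]:] * U ^ i * V ^ (e - i))"

abbreviation (input) "varX \<equiv> ([:0, 1:] :: 'a::field bipoly)"
abbreviation (input) "varY \<equiv> ([:[:0, 1:]:] :: 'a::field bipoly)"

lemma homogenize_0 [simp]: "homogenize U V e 0 = 0"
  by (simp add: homogenize_def)

text \<open>Horner recursion in the order in which \<open>pCons\<close> builds polynomials; it
  drives the induction in \<open>homogenize_mult\<close>.\<close>

lemma homogenize_pCons:
  "homogenize U V (Suc e) (pCons a h) = [:[:a:]:] * V ^ Suc e + U * homogenize U V e h"
  unfolding homogenize_def
  by (subst sum.atMost_Suc_shift) (simp add: sum_distrib_left algebra_simps)

lemma homogenize_add:
  fixes U V :: "'a::field bipoly"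
  shows "homogenize U V e (f + g) = homogenize U V e f + homogenize U V e g"
proof -
  have "[:[:a + b:]:] = [:[:a:]:] + ([:[:b:]:] :: 'a bipoly)" for a b
    by simp
  then show ?thesis
    by (simp only: homogenize_def coeff_add ring_distribs sum.distrib)
qed

lemma homogenize_smult:
  fixes U V :: "'a::field bipoly"
  shows "homogenize U V e (Polynomial.smult a f) = [:[:a:]:] * homogenize U V e f"
proof -
  have "[:[:a * b:]:] = [:[:a:]:] * ([:[:b:]:] :: 'a bipoly)" for a b
    by simp
  then show ?thesis
    by (simp only: homogenize_def coeff_smult sum_distrib_left mult.assoc)
qed

text \<open>Degree in excess turns into powers of V: the coefficients above n vanish, and every
  remaining term has V^k to spare.\<close>

lemma homogenize_extend:
  assumes "Polynomial.degree h \<le> n"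
  shows "homogenize U V (n + k) h = V ^ k * homogenize U V n h"
proof -
  have "homogenize U V (n + k) h = (\<Sum>i\<le>n. [:[:poly.coeff h i:]:] * U ^ i * V ^ (n + k - i))"
    unfolding homogenize_def
    by (rule sum.mono_neutral_right) (use assms in \<open>auto simp: coeff_eq_0\<close>)
  also have "\<dots> = (\<Sum>i\<le>n. V ^ k * ([:[:poly.coeff h i:]:] * U ^ i * V ^ (n - i)))"
  proof (rule sum.cong)
    fix i assume "i \<in> {..n}"
    then have "n + k - i = (n - i) + k"
      by auto
    then show "[:[:poly.coeff h i:]:] * U ^ i * V ^ (n + k - i)
      = V ^ k * ([:[:poly.coeff h i:]:] * U ^ i * V ^ (n - i))"
      by (simp only: power_add mult_ac)
  qed simp
  finally show ?thesis
    by (simp add: homogenize_def sum_distrib_left)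
qed

text \<open>The bounds m and n may exceed the degrees. The bound on f drops by one with each
  \<open>pCons\<close>, and the term a g, homogenized in degree n + m, is brought down to degree n
  by \<open>homogenize_extend\<close>.\<close>

lemma homogenize_mult:
  assumes "Polynomial.degree f \<le> m" "Polynomial.degree g \<le> n"
  shows "homogenize U V (m + n) (f * g) = homogenize U V m f * homogenize U V n g"
  using assms(1)
proof (induction f arbitrary: m)
  case 0
  then show ?case by simp
next
  case (pCons a f)
  show ?case
  proof (cases m)
    case 0
    then have "f = 0"
      using pCons.prems by (auto split: if_splits)
    then show ?thesis
      using 0 by (simp add: homogenize_smult) (simp add: homogenize_def)
  next
    case (Suc k)
    then have k: "Polynomial.degree f \<le> k"
      using pCons.prems by (cases "f = 0") auto
    have "homogenize U V (m + n) (pCons a f * g)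
        = [:[:a:]:] * homogenize U V (n + m) g + U * homogenize U V (k + n) (f * g)"
      using homogenize_pCons[of U V "k + n" 0 "f * g"]
      by (simp add: Suc homogenize_add homogenize_smult add.commute)
    also have "\<dots> = ([:[:a:]:] * V ^ m + U * homogenize U V k f) * homogenize U V n g"
      by (simp only: homogenize_extend[OF assms(2)] pCons.IH[OF k] ring_distribs mult_ac)
    finally show ?thesis
      by (simp only: Suc homogenize_pCons)
  qed
qed

text \<open>The cofactor is given the whole remaining degree d - deg h, which may exceed its own;
  the surplus is a power of V.\<close>

lemma homogenize_dvd:
  assumes "h dvd f" "Polynomial.degree f \<le> d"
  shows "homogenize U V (Polynomial.degree h) h dvd homogenize U V d f"
proof (cases "f = 0")
  case False
  obtain k where k: "f = h * k"
    using assms(1) by blast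
  with False have "Polynomial.degree f = Polynomial.degree h + Polynomial.degree k"
    by (auto intro!: degree_mult_eq)
  then have "homogenize U V d f
      = homogenize U V (Polynomial.degree h) h * homogenize U V (d - Polynomial.degree h) k"
    using homogenize_mult[of h "Polynomial.degree h" k "d - Polynomial.degree h" U V] assms(2)
    by (simp add: k)
  then show ?thesis
    by simp
qed simp

text \<open>A common divisor of positive degree would homogenize to a nonunit dividing both forms.
  The nonunit hypothesis stays abstract so that one argument serves both orders of the
  variables.\<close>

lemma coprime_dehomogenize:
  assumes cop: "coprime (homogenize U V d f) (homogenize U V d g)"
    and deg: "Polynomial.degree f \<le> d" "Polynomial.degree g \<le> d"
    and non_unit: "\<And>h. Polynomial.degree h > 0 \<Longrightarrow> \<not> is_unit (homogenize U V (Polynomial.degree h) h)"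
  shows "coprime f g"
proof (rule coprimeI)
  fix h assume h: "h dvd f" "h dvd g"
  have "h \<noteq> 0"
    using h cop by auto
  have "is_unit (homogenize U V (Polynomial.degree h) h)"
    using cop by (rule coprime_common_divisor) (use h deg in \<open>auto intro: homogenize_dvd\<close>)
  then have "Polynomial.degree h = 0"
    using non_unit by auto
  then show "is_unit h"
    using \<open>h \<noteq> 0\<close> by (simp add: is_unit_iff_degree)
qed

lemma var_monom:
  fixes c :: "'a::field"
  shows "[:[:c:]:] * varX ^ i * varY ^ j = Polynomial.monom (Polynomial.monom c j) i"
  "[:[:c:]:] * varY ^ j * varX ^ i = Polynomial.monom (Polynomial.monom c j) i"
proof -
  have "(varY :: 'a bipoly) ^ j = [:[:0, 1:] ^ j:]"
    by (induction j) auto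
  then have "[:[:c:]:] * varX ^ i * varY ^ j
      = Polynomial.smult ([:c:] * [:0, 1:] ^ j) (varX ^ i)"
    by (simp add: mult.commute)
  then show "[:[:c:]:] * varX ^ i * varY ^ j = Polynomial.monom (Polynomial.monom c j) i"
    by (simp add: Polynomial.monom_altdef Polynomial.smult_monom mult.commute)
  then show "[:[:c:]:] * varY ^ j * varX ^ i = Polynomial.monom (Polynomial.monom c j) i"
    by (simp only: mult_ac)
qed

lemma coeff_homogenize_XY:
  "poly.coeff (poly.coeff (homogenize varX varY e h) i) j = (if i + j = e then poly.coeff h i else 0)"
proof -
  have "poly.coeff (poly.coeff (homogenize varX varY e h) i) j
      = (\<Sum>k\<le>e. if k = i \<and> e - k = j then poly.coeff h k else 0)"
    by (simp only: homogenize_def var_monom Polynomial.coeff_sum Polynomial.coeff_monom)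
       (auto intro!: sum.cong)
  also have "\<dots> = (\<Sum>k\<le>e. if k = i then (if i + j = e then poly.coeff h i else 0) else 0)"
    by (rule sum.cong) auto
  finally show ?thesis
    by auto
qed

lemma coeff_homogenize_YX:
  "poly.coeff (poly.coeff (homogenize varY varX e h) i) j = (if i + j = e then poly.coeff h j else 0)"
proof -
  have "poly.coeff (poly.coeff (homogenize varY varX e h) i) j
      = (\<Sum>k\<le>e. if e - k = i \<and> k = j then poly.coeff h k else 0)"
    by (simp only: homogenize_def var_monom Polynomial.coeff_sum Polynomial.coeff_monom)
       (auto intro!: sum.cong)
  also have "\<dots> = (\<Sum>k\<le>e. if k = j then (if i + j = e then poly.coeff h j else 0) else 0)"
    by (rule sum.cong) auto
  finally show ?thesis
    by auto
qed

lemma homogenize_XY_not_unit: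
  assumes "Polynomial.degree h > 0"
  shows "\<not> is_unit (homogenize varX varY (Polynomial.degree h) h)"
proof
  let ?H = "homogenize varX varY (Polynomial.degree h) h"
  assume "is_unit ?H"
  then have "poly.coeff ?H (Polynomial.degree h) = 0"
    using assms by (auto simp: is_unit_poly_iff coeff_pCons split: nat.splits)
  then have "poly.coeff (poly.coeff ?H (Polynomial.degree h)) 0 = 0"
    by simp
  then show False
    using assms by (subst (asm) coeff_homogenize_XY) auto
qed

text \<open>The leading coefficient of h now sits in the coefficient of x^0, which a unit of K[y][x]
  may well have; so the unit property has to be unfolded a second time, in K[y].\<close>

lemma homogenize_YX_not_unit:
  assumes "Polynomial.degree h > 0"
  shows "\<not> is_unit (homogenize varY varX (Polynomial.degree h) h)"
proof
  let ?H = "homogenize varY varX (Polynomial.degree h) h"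
  assume "is_unit ?H"
  then obtain c where "?H = [:c:]" "is_unit c"
    by (auto simp: is_unit_poly_iff)
  then have "poly.coeff (poly.coeff ?H 0) (Polynomial.degree h) = 0"
    using assms by (auto simp: is_unit_poly_iff coeff_pCons split: nat.splits)
  then show False
    using assms by (subst (asm) coeff_homogenize_YX) auto
qed

text \<open>An equation in the shape of \<open>coeff_homogenize_XY\<close>, so that in
  \<open>homogeneous_eq_homogenize\<close> both sides become conditionals on i + j = d.\<close>

lemma homogeneous_coeff:
  assumes "homogeneous d F"
  shows "poly.coeff (poly.coeff F i) j = (if i + j = d then poly.coeff (poly.coeff F i) j else 0)"
  using assms by (auto simp: homogeneous_def bisupport_def)

lemma homogeneous_eq_homogenize:
  assumes "homogeneous d F"
  obtains f g where "Polynomial.degree f \<le> d" "F = homogenize varX varY d f"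
    "Polynomial.degree g \<le> d" "F = homogenize varY varX d g"
proof
  \<comment> \<open>f(t) = F(t, 1) and g(t) = F(1, t).\<close>
  define f where "f = (\<Sum>i\<le>d. Polynomial.monom (poly.coeff (poly.coeff F i) (d - i)) i)"
  define g where "g = (\<Sum>i\<le>d. Polynomial.monom (poly.coeff (poly.coeff F (d - i)) i) i)"
  have f: "poly.coeff f i = (if i \<le> d then poly.coeff (poly.coeff F i) (d - i) else 0)" for i
    by (simp add: f_def Polynomial.coeff_sum)
  have g: "poly.coeff g i = (if i \<le> d then poly.coeff (poly.coeff F (d - i)) i else 0)" for i
    by (simp add: g_def Polynomial.coeff_sum)
  show "Polynomial.degree f \<le> d" "Polynomial.degree g \<le> d"
    by (rule degree_le; simp add: f g)+
  show "F = homogenize varX varY d f"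
    by (intro poly_eqI, subst coeff_homogenize_XY, subst homogeneous_coeff[OF assms]) (auto simp: f)
  show "F = homogenize varY varX d g"
    by (intro poly_eqI, subst coeff_homogenize_YX, subst homogeneous_coeff[OF assms]) (auto simp: g)
qed

section \<open>Evaluation of forms over K\<close>

lemma global_ring_simps [simp]:
  "carrier (global_ring :: 'a::field ring) = UNIV"
  "x \<otimes>\<^bsub>(global_ring :: 'a ring)\<^esub> y = x * y"
  "x \<oplus>\<^bsub>(global_ring :: 'a ring)\<^esub> y = x + y"
  "\<zero>\<^bsub>(global_ring :: 'a ring)\<^esub> = 0"
  "\<one>\<^bsub>(global_ring :: 'a ring)\<^esub> = 1"
  by (simp_all add: ring_of_type_algebra_def)

lemma global_ring_nat_pow [simp]: "x [^]\<^bsub>(global_ring :: 'a::field ring)\<^esub> (n::nat) = x ^ n"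
proof -
  interpret ring "global_ring :: 'a ring" by rule
  show ?thesis
    by (induction n) (simp_all add: mult.commute)
qed

lemma global_ring_finsum [simp]:
  assumes "finite A"
  shows "finsum (global_ring :: 'a::field ring) f A = sum f A"
proof -
  interpret ring "global_ring :: 'a ring" by rule
  show ?thesis
    using assms by induction simp_all
qed

lemma finite_bisupport: "finite (bisupport F)"
proof (rule finite_subset)
  show "bisupport F \<subseteq> (SIGMA i:{..Polynomial.degree F}. {..Polynomial.degree (poly.coeff F i)})"
    by (auto simp: bisupport_def intro!: le_degree)
qed simp

text \<open>Evaluation becomes an iterated \<open>poly\<close>, with x as the outer variable, so
  that the homomorphism rules for \<open>poly\<close> apply to forms given by
  \<open>homogenize\<close>.\<close>

lemma bieval_global: "bieval global_ring id F (x, y) = poly (poly F [:x:]) y"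
proof -
  let ?T = "SIGMA i:{..Polynomial.degree F}. {..Polynomial.degree (poly.coeff F i)}"
  have "bieval global_ring id F (x, y)
      = (\<Sum>k\<in>bisupport F. poly.coeff (poly.coeff F (fst k)) (snd k) * (x ^ fst k * y ^ snd k))"
    by (simp add: bieval_def finite_bisupport)
  also have "\<dots> = (\<Sum>k\<in>?T. poly.coeff (poly.coeff F (fst k)) (snd k) * (x ^ fst k * y ^ snd k))"
    by (rule sum.mono_neutral_left) (auto simp: bisupport_def intro!: le_degree)
  also have "\<dots> = (\<Sum>i\<le>Polynomial.degree F. \<Sum>j\<le>Polynomial.degree (poly.coeff F i).
      poly.coeff (poly.coeff F i) j * (x ^ i * y ^ j))"
    by (simp add: sum.Sigma split_beta)
  also have "\<dots> = poly (poly F [:x:]) y"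
    by (subst poly_altdef)
       (simp add: poly_sum poly_altdef[of "poly.coeff F _"] poly_power sum_distrib_left mult_ac)
  finally show ?thesis .
qed

lemma bieval_homogenize:
  assumes "Polynomial.degree f \<le> d"
  shows "y \<noteq> 0 \<Longrightarrow> bieval global_ring id (homogenize varX varY d f) (x, y) = y ^ d * poly f (x / y)"
    and "x \<noteq> 0 \<Longrightarrow> bieval global_ring id (homogenize varY varX d f) (x, y) = x ^ d * poly f (y / x)"
proof -
  have *: "(\<Sum>i\<le>d. poly.coeff f i * (s ^ i * t ^ (d - i))) = t ^ d * poly f (s / t)" if "t \<noteq> 0" for s t
  proof -
    have "poly f (s / t) = (\<Sum>i\<le>d. poly.coeff f i * (s / t) ^ i)"
      unfolding poly_altdef
      by (rule sum.mono_neutral_left) (use assms in \<open>auto simp: coeff_eq_0\<close>)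
    then show ?thesis
      using that by (auto simp: sum_distrib_left power_diff power_divide intro!: sum.cong)
  qed
  show "y \<noteq> 0 \<Longrightarrow> bieval global_ring id (homogenize varX varY d f) (x, y) = y ^ d * poly f (x / y)"
    by (simp add: bieval_global homogenize_def poly_sum poly_power *)
  show "x \<noteq> 0 \<Longrightarrow> bieval global_ring id (homogenize varY varX d f) (x, y) = x ^ d * poly f (y / x)"
    by (simp add: bieval_global homogenize_def poly_sum poly_power *)
qed

text \<open>There are two Bezout identities because one chart misses a point: forms with the common
  factor y can still be coprime after setting y = 1.\<close>

lemma coprime_forms_charts:
  assumes "homogeneous d F" "homogeneous d G" "coprime F G"
  obtains f g a b f' g' a' b' where
    "a * f + b * g = 1"
    "\<And>x y. y \<noteq> 0 \<Longrightarrow> bieval global_ring id F (x, y) = y ^ d * poly f (x / y)"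
    "\<And>x y. y \<noteq> 0 \<Longrightarrow> bieval global_ring id G (x, y) = y ^ d * poly g (x / y)"
    "a' * f' + b' * g' = 1"
    "\<And>x y. x \<noteq> 0 \<Longrightarrow> bieval global_ring id F (x, y) = x ^ d * poly f' (y / x)"
    "\<And>x y. x \<noteq> 0 \<Longrightarrow> bieval global_ring id G (x, y) = x ^ d * poly g' (y / x)"
proof -
  obtain f f' where F: "Polynomial.degree f \<le> d" "F = homogenize varX varY d f"
      "Polynomial.degree f' \<le> d" "F = homogenize varY varX d f'"
    using homogeneous_eq_homogenize[OF assms(1)] by metis
  obtain g g' where G: "Polynomial.degree g \<le> d" "G = homogenize varX varY d g"
      "Polynomial.degree g' \<le> d" "G = homogenize varY varX d g'"
    using homogeneous_eq_homogenize[OF assms(2)] by metis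
  have "coprime f g"
    using assms(3) F(1) G(1) homogenize_XY_not_unit unfolding F(2) G(2)
    by (rule coprime_dehomogenize)
  moreover have "coprime f' g'"
    using assms(3) F(3) G(3) homogenize_YX_not_unit unfolding F(4) G(4)
    by (rule coprime_dehomogenize)
  ultimately obtain a b a' b' where "a * f + b * g = 1" "a' * f' + b' * g' = 1"
    using poly_bezout by metis
  then show ?thesis
    using that[of a f b g a' f' b' g'] F G bieval_homogenize by metis
qed

lemma bieval_homogeneous_scale:
  assumes "homogeneous d F"
  shows "bieval global_ring id F (c * x, c * y) = c ^ d * bieval global_ring id F (x, y)"
proof -
  have "bieval global_ring id F (c * x, c * y) = (\<Sum>k\<in>bisupport F. c ^ d *
      (poly.coeff (poly.coeff F (fst k)) (snd k) * (x ^ fst k * y ^ snd k)))"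
    unfolding bieval_def using assms
    by (auto simp: finite_bisupport homogeneous_def power_mult_distrib power_add algebra_simps
        intro!: sum.cong)
  then show ?thesis
    by (simp add: bieval_def finite_bisupport sum_distrib_left)
qed

section \<open>Bounds summable over the places\<close>

locale abs_value =
  fixes v :: "'a::field \<Rightarrow> real"
  assumes absolute_value: "absolute_value v"
begin

lemma nonneg [simp]: "0 \<le> v x"
  and zero_iff [simp]: "v x = 0 \<longleftrightarrow> x = 0"
  and mult: "v (x * y) = v x * v y"
  and triangle: "v (x + y) \<le> v x + v y"
  using absolute_value by (auto simp: absolute_value_def)

lemma zero [simp]: "v 0 = 0"
  by simp

lemma pos_iff [simp]: "0 < v x \<longleftrightarrow> x \<noteq> 0"
  using nonneg[of x] zero_iff[of x] by linarith

lemma one [simp]: "v 1 = 1"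
  using mult[of 1 1] by simp

lemma minus [simp]: "v (- x) = v x"
proof -
  have "v (- 1) * v (- 1) = 1"
    by (simp flip: mult)
  then have "v (- 1) = 1"
    using nonneg[of "- 1"] by (simp add: square_eq_1_iff)
  then show ?thesis
    using mult[of "- 1" x] by simp
qed

lemma power: "v (x ^ n) = v x ^ n"
  by (induction n) (simp_all add: mult)

lemma divide: "v (x / y) = v x / v y"
proof (cases "y = 0")
  case False
  then show ?thesis
    using mult[of "x / y" y] by (simp add: field_simps)
qed simp

lemma diff_ge: "\<bar>v x - v y\<bar> \<le> v (x - y)"
  using triangle[of "x - y" y] triangle[of "y - x" x] minus[of "x - y"] by simp

lemma sum_le: "v (sum f A) \<le> (\<Sum>k\<in>A. v (f k))"
proof (induction A rule: infinite_finite_induct)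
  case (insert k A)
  then show ?case
    using triangle[of "f k" "sum f A"] by simp
qed simp_all

lemma of_nat_le: "v (of_nat n) \<le> real n"
proof (induction n)
  case (Suc n)
  then show ?case
    using triangle[of 1 "of_nat n"] by simp
qed simp

text \<open>If |a + b| exceeded m = max(|a|, |b|), the ratio |a + b|^n / m^n would grow
  exponentially in n. But the binomial expansion has n + 1 terms of size at most m^n, the binomial
  coefficients being integers.\<close>

lemma ultrametric:
  assumes "\<And>n. v (of_nat n) \<le> 1"
  shows "v (a + b) \<le> max (v a) (v b)"
proof (rule ccontr)
  define m where "m = max (v a) (v b)"
  assume "\<not> ?thesis"
  then have gt: "m < v (a + b)"
    unfolding m_def by (simp only: not_le)
  have "m \<noteq> 0"
  proof
    assume "m = 0"
    then have "v a \<le> 0" "v b \<le> 0"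
      by (simp_all add: m_def)
    then have "v a = 0" "v b = 0"
      using nonneg by (auto intro: order.antisym simp del: zero_iff)
    then have "a = 0" "b = 0"
      by simp_all
    then show False
      using gt \<open>m = 0\<close> by simp
  qed
  moreover have "0 \<le> m"
    by (simp add: m_def max.coboundedI1)
  ultimately have m: "0 < m"
    by simp
  have bound: "v (a + b) ^ n \<le> (real n + 1) * m ^ n" for n
  proof -
    have "v (a + b) ^ n = v (\<Sum>k\<le>n. of_nat (n choose k) * a ^ k * b ^ (n - k))"
      by (simp flip: power add: binomial_ring)
    also have "\<dots> \<le> (\<Sum>k\<le>n. v (of_nat (n choose k)) * (v a ^ k * v b ^ (n - k)))"
      by (rule order.trans[OF sum_le]) (simp add: mult power mult.assoc)
    also have "\<dots> \<le> (\<Sum>k\<le>n. 1 * (m ^ k * m ^ (n - k)))"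
      by (intro sum_mono mult_mono power_mono assms) (auto simp: m_def max.coboundedI1)
    also have "\<dots> = (\<Sum>k\<le>n. m ^ n)"
      by (rule sum.cong) (auto simp flip: power_add)
    finally show ?thesis
      by (simp add: algebra_simps)
  qed
  define e where "e = v (a + b) / m - 1"
  have e: "0 < e"
    using gt m by (simp add: e_def)
  \<comment> \<open>Bernoulli's inequality alone gives linear growth, no better than the bound. Its
    square, hence the exponent 2k, contributes k^2 e^2, which beats 2k once k > 2 / e^2.\<close>
  obtain k :: nat where k: "2 / e\<^sup>2 < real k"
    using reals_Archimedean2 by blast
  have k': "2 < real k * e\<^sup>2" "0 < real k"
  proof -
    show "2 < real k * e\<^sup>2"
      using k e by (simp add: divide_less_eq)
    have "0 < 2 / e\<^sup>2"
      using e by simp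
    then show "0 < real k"
      using k by (rule less_trans)
  qed
  have "(1 + real k * e)\<^sup>2 \<le> ((1 + e) ^ k)\<^sup>2"
    using Bernoulli_inequality[of e k] e by (intro power_mono) auto
  also have "\<dots> = (v (a + b) / m) ^ (2 * k)"
    by (simp add: e_def power_even_eq)
  also have "\<dots> \<le> 2 * real k + 1"
    using bound[of "2 * k"] m by (simp add: power_divide divide_le_eq)
  finally have "real k * (real k * e\<^sup>2) + 2 * real k * e \<le> 2 * real k"
    by (simp add: power2_eq_square algebra_simps)
  moreover have "real k * 2 < real k * (real k * e\<^sup>2)"
    using k' by (intro mult_strict_left_mono) auto
  moreover have "0 < 2 * real k * e"
    using k' e by simp
  ultimately show False
    by linarith
qed

end

lemma places_abs_value: "v \<in> places F \<Longrightarrow> abs_value v"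
  by (simp add: places_def abs_value_def)

text \<open>The constant 2 of the archimedean triangle inequality is $|2|_v$, and for the other places
  the factor is harmless: this makes it summable over the places by the product formula.\<close>
lemma place_add_le:
  assumes "v \<in> places F"
  shows "v (a + b) \<le> exp \<bar>ln (v 2)\<bar> * max (v a) (v b)"
proof -
  interpret abs_value v
    using assms by (rule places_abs_value)
  \<comment> \<open>The factor is at least 1 whatever v 2 is; in characteristic 2, where v 2 = 0, it
    equals 1 by \<open>ln 0 = 0\<close>.\<close>
  have ultra: ?thesis if "\<And>n. v (of_nat n) \<le> 1"
  proof -
    have "1 * max (v a) (v b) \<le> exp \<bar>ln (v 2)\<bar> * max (v a) (v b)"
      by (intro mult_right_mono) (auto simp: max.coboundedI1)
    then show ?thesis
      using ultrametric[OF that, of a b] by (simp only: mult_1)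
  qed
  show ?thesis
  proof (cases "CHAR('a) = 0")
    case True
    then have "standard_on_rationals v"
      using assms by (simp add: places_def)
    then consider "\<forall>m::int. v (of_int m) = \<bar>of_int m\<bar>"
      | p where "Factorial_Ring.prime p"
        "\<forall>m::int. m \<noteq> 0 \<longrightarrow> v (of_int m) = (1 / real p) ^ multiplicity (int p) m"
      unfolding standard_on_rationals_def by (elim disjE exE conjE)
    then show ?thesis
    proof cases
      case 1
      \<comment> \<open>Here the factor is exp |ln 2| = 2, and the triangle inequality bounds the
        sum by twice the maximum.\<close>
      then have "v 2 = 2"
        by (metis abs_numeral of_int_numeral)
      then show ?thesis
        using triangle[of a b] by simp
    next
      case (2 p)
      have "v (of_nat n) \<le> 1" for n
      proof (cases "n = 0")
        case False
        then have "v (of_nat n) = (1 / real p) ^ multiplicity (int p) (int n)"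
          using 2(2)[rule_format, of "int n"] by simp
        also have "\<dots> \<le> 1"
          using prime_ge_1_nat[OF 2(1)] by (intro power_le_one) (auto simp: divide_le_eq)
        finally show ?thesis .
      qed simp
      then show ?thesis
        by (rule ultra)
    qed
  next
    case False
    \<comment> \<open>In positive characteristic the integers of K are finitely many residues, so v
      is bounded on them. Powers of integers are again integers, so a value above 1 would contradict
      the bound.\<close>
    have bound: "v (of_nat n) \<le> real CHAR('a)" for n
    proof -
      have "(of_nat n :: 'a) = of_nat (n mod CHAR('a))"
        by (subst div_mult_mod_eq[of n "CHAR('a)", symmetric])
           (simp only: of_nat_add of_nat_mult of_nat_CHAR mult_zero_right add_0_left)
      then have "v (of_nat n) \<le> real (n mod CHAR('a))"
        using of_nat_le[of "n mod CHAR('a)"] by simp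
      also have "\<dots> \<le> real CHAR('a)"
        using False by (simp add: less_imp_le)
      finally show ?thesis .
    qed
    have "v (of_nat n) \<le> 1" for n
    proof (rule ccontr)
      assume "\<not> ?thesis"
      then obtain k where "real CHAR('a) < v (of_nat n) ^ k"
        using real_arch_pow[of "v (of_nat n)" "real CHAR('a)"] by auto
      then show False
        using bound[of "n ^ k"] by (simp add: power)
    qed
    then show ?thesis
      by (rule ultra)
  qed
qed

text \<open>Nonnegativity is built in so that estimates can be merged by adding their constants: the
  sum dominates each summand.\<close>

definition adelic :: "'a::field set \<Rightarrow> (('a \<Rightarrow> real) \<Rightarrow> real) \<Rightarrow> bool" where
  "adelic F C \<longleftrightarrow> (\<forall>v\<in>places F. 0 \<le> C v) \<and> (\<lambda>v. local_degree F v * C v) summable_on places F"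

lemma local_degree_nonneg [simp]: "0 \<le> local_degree F v"
  by (simp add: local_degree_def)

lemma adelic_nonneg: "adelic F C \<Longrightarrow> v \<in> places F \<Longrightarrow> 0 \<le> C v"
  by (simp add: adelic_def)

lemma adelic_add: "adelic F C \<Longrightarrow> adelic F D \<Longrightarrow> adelic F (\<lambda>v. C v + D v)"
  by (auto simp: adelic_def distrib_left intro: summable_on_add)

lemma adelic_zero: "adelic F (\<lambda>v. 0)"
  by (simp add: adelic_def)

lemma adelic_sum:
  assumes "finite A" "\<And>k. k \<in> A \<Longrightarrow> adelic F (C k)"
  shows "adelic F (\<lambda>v. \<Sum>k\<in>A. C k v)"
  using assms by (induction A) (auto intro: adelic_add adelic_zero)

text \<open>In the reals \<open>has_sum\<close> is unconditional, hence absolute, convergence. Every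
  nontrivial \<open>adelic\<close> constant is built from this one; c = 0 is covered by
  \<open>ln 0 = 0\<close>.\<close>

lemma adelic_ln:
  assumes "product_formula F"
  shows "adelic F (\<lambda>v. \<bar>ln (v c)\<bar>)"
proof (cases "c = 0")
  case True
  have "ln (v c) = 0" if "v \<in> places F" for v
  proof -
    interpret abs_value v
      using that by (rule places_abs_value)
    show ?thesis
      using True by simp
  qed
  then show ?thesis
    by (simp add: adelic_def summable_on_cong[where g = "\<lambda>_. 0"])
next
  case False
  then have "(\<lambda>v. local_degree F v * ln (v c)) summable_on places F"
    using assms unfolding product_formula_def by (meson has_sum_imp_summable)
  then have "(\<lambda>v. \<bar>local_degree F v * ln (v c)\<bar>) summable_on places F"
    using summable_on_iff_abs_summable_on_real by fastforce
  then show ?thesis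
    by (simp add: adelic_def abs_mult)
qed

section \<open>Two-sided bounds for polynomials and lifts\<close>

lemma adelic_poly_bound:
  assumes "product_formula F"
  obtains C where "adelic F C" "\<And>v t. v \<in> places F \<Longrightarrow> v t \<le> 1 \<Longrightarrow> v (poly f t) \<le> exp (C v)"
proof -
  have "\<exists>C. adelic F C \<and> (\<forall>v t. v \<in> places F \<longrightarrow> v t \<le> 1 \<longrightarrow> v (poly f t) \<le> exp (C v))"
  proof (induction f)
    case 0
    have "v (poly 0 t) \<le> exp 0" if "v \<in> places F" for v and t :: 'a
    proof -
      interpret abs_value v
        using that by (rule places_abs_value)
      show ?thesis
        by simp
    qed
    then show ?case
      using adelic_zero by blast
  next
    case (pCons a f)
    then obtain C where C: "adelic F C" "\<And>v t. v \<in> places F \<Longrightarrow> v t \<le> 1 \<Longrightarrow> v (poly f t) \<le> exp (C v)"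
      by blast
    \<comment> \<open>Cost of one Horner step a + t f(t): |2| for the addition, |a| for the new
      coefficient, C for the rest. The factor t is free because |t| \<le> 1.\<close>
    define D where "D = (\<lambda>v::'a \<Rightarrow> real. \<bar>ln (v 2)\<bar> + (\<bar>ln (v a)\<bar> + C v))"
    have "v (poly (pCons a f) t) \<le> exp (D v)" if v: "v \<in> places F" and t: "v t \<le> 1" for v t
    proof -
      interpret abs_value v
        using v by (rule places_abs_value)
      have C0: "0 \<le> C v"
        using C(1) v by (rule adelic_nonneg)
      \<comment> \<open>For a = 0 this reads 0 \<le> exp 0, by \<open>ln 0 = 0\<close>.\<close>
      have "v a \<le> exp \<bar>ln (v a)\<bar>"
        by (cases "a = 0") (simp_all add: order.trans[OF eq_refl[OF exp_ln[symmetric]]])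
      also have "\<dots> \<le> exp (\<bar>ln (v a)\<bar> + C v)"
        using C0 by simp
      finally have a: "v a \<le> exp (\<bar>ln (v a)\<bar> + C v)" .
      have "v (t * poly f t) \<le> 1 * exp (C v)"
        unfolding mult using t C(2)[OF v t] by (intro mult_mono) auto
      also have "\<dots> \<le> exp (\<bar>ln (v a)\<bar> + C v)"
        by simp
      finally have "max (v a) (v (t * poly f t)) \<le> exp (\<bar>ln (v a)\<bar> + C v)"
        using a by simp
      then have "exp \<bar>ln (v 2)\<bar> * max (v a) (v (t * poly f t)) \<le> exp (D v)"
        by (simp add: D_def exp_add[of "\<bar>ln (v 2)\<bar>"])
      then show ?thesis
        using place_add_le[OF v, of a "t * poly f t"] by simp
    qed
    moreover have "adelic F D"
      unfolding D_def by (intro adelic_add adelic_ln assms C)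
    ultimately show ?case
      by blast
  qed
  then show ?thesis
    using that by blast
qed

text \<open>Since a(t) and b(t) are bounded for |t| \<le> 1, the values f(t) and g(t) cannot both be
  small: 1 is at most the addition factor times the larger of |a(t) f(t)| and |b(t) g(t)|.\<close>

lemma adelic_coprime_bound:
  fixes f g :: "'a::field poly"
  assumes "product_formula F" "a * f + b * g = 1"
  obtains C where "adelic F C"
    "\<And>v t. v \<in> places F \<Longrightarrow> v t \<le> 1 \<Longrightarrow> exp (- C v) \<le> max (v (poly f t)) (v (poly g t))"
    "\<And>v t. v \<in> places F \<Longrightarrow> v t \<le> 1 \<Longrightarrow> max (v (poly f t)) (v (poly g t)) \<le> exp (C v)"
proof -
  obtain Cf where Cf: "adelic F Cf" "\<And>v t. v \<in> places F \<Longrightarrow> v t \<le> 1 \<Longrightarrow> v (poly f t) \<le> exp (Cf v)"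
    using adelic_poly_bound[OF assms(1)] by blast
  obtain Cg where Cg: "adelic F Cg" "\<And>v t. v \<in> places F \<Longrightarrow> v t \<le> 1 \<Longrightarrow> v (poly g t) \<le> exp (Cg v)"
    using adelic_poly_bound[OF assms(1)] by blast
  obtain Ca where Ca: "adelic F Ca" "\<And>v t. v \<in> places F \<Longrightarrow> v t \<le> 1 \<Longrightarrow> v (poly a t) \<le> exp (Ca v)"
    using adelic_poly_bound[OF assms(1)] by blast
  obtain Cb where Cb: "adelic F Cb" "\<And>v t. v \<in> places F \<Longrightarrow> v t \<le> 1 \<Longrightarrow> v (poly b t) \<le> exp (Cb v)"
    using adelic_poly_bound[OF assms(1)] by blast
  define D where "D = (\<lambda>v::'a \<Rightarrow> real. \<bar>ln (v 2)\<bar> + (Ca v + Cb v))"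
  have D: "adelic F D"
    unfolding D_def by (intro adelic_add adelic_ln assms Ca Cb)
  show ?thesis
  proof
    show "adelic F (\<lambda>v. D v + (Cf v + Cg v))"
      by (intro adelic_add D Cf Cg)
  next
    fix v t assume v: "v \<in> places F" and t: "v t \<le> 1"
    interpret abs_value v
      using v by (rule places_abs_value)
    note pos = adelic_nonneg[OF Cf(1) v] adelic_nonneg[OF Cg(1) v]
      adelic_nonneg[OF Ca(1) v] adelic_nonneg[OF Cb(1) v] adelic_nonneg[OF D v]
    let ?M = "max (v (poly f t)) (v (poly g t))"
    have "v (poly f t) \<le> exp (Cf v)" "v (poly g t) \<le> exp (Cg v)"
      using Cf Cg v t by auto
    moreover have "exp (Cf v) \<le> exp (D v + (Cf v + Cg v))" "exp (Cg v) \<le> exp (D v + (Cf v + Cg v))"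
      using pos by simp_all
    ultimately show "?M \<le> exp (D v + (Cf v + Cg v))"
      by linarith
    have M0: "0 \<le> ?M"
      by (simp add: max.coboundedI1)
    have "v (poly a t * poly f t) \<le> exp (Ca v + Cb v) * ?M"
      unfolding mult
      using Ca(2)[OF v t] pos by (intro mult_mono) (auto intro: order.trans)
    moreover have "v (poly b t * poly g t) \<le> exp (Ca v + Cb v) * ?M"
      unfolding mult
      using Cb(2)[OF v t] pos by (intro mult_mono) (auto intro: order.trans)
    ultimately have "max (v (poly a t * poly f t)) (v (poly b t * poly g t)) \<le> exp (Ca v + Cb v) * ?M"
      by simp
    then have "exp \<bar>ln (v 2)\<bar> * max (v (poly a t * poly f t)) (v (poly b t * poly g t)) \<le> exp (D v) * ?M"
      by (simp add: D_def exp_add[of "\<bar>ln (v 2)\<bar>"] mult.assoc)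
    moreover have "poly a t * poly f t + poly b t * poly g t = 1"
      using arg_cong[OF assms(2), of "\<lambda>p. poly p t"] by simp
    ultimately have "1 \<le> exp (D v) * ?M"
      using place_add_le[OF v, of "poly a t * poly f t" "poly b t * poly g t"] by simp
    then have "exp (- D v) \<le> ?M"
      by (simp add: exp_minus field_simps)
    moreover have "exp (- (D v + (Cf v + Cg v))) \<le> exp (- D v)"
      using pos by simp
    ultimately show "exp (- (D v + (Cf v + Cg v))) \<le> ?M"
      by linarith
  qed
qed

text \<open>Dividing by the coordinate z of larger absolute value puts the point at some t with |t|
  \<le> 1 in the chart z = 1, and homogeneity restores |z|^d. Which chart is used depends on the
  point and on v, so the constants of both are added.\<close>

lemma adelic_lift_bound:
  fixes P Q :: "'a::field bipoly"
  assumes "product_formula F" "homogeneous d P" "homogeneous d Q" "coprime P Q"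
  obtains C where "adelic F C"
    "\<And>v x y. v \<in> places F \<Longrightarrow> (x, y) \<noteq> (0, 0) \<Longrightarrow> exp (- C v) * max (v x) (v y) ^ d
        \<le> max (v (bieval global_ring id P (x, y))) (v (bieval global_ring id Q (x, y)))"
    "\<And>v x y. v \<in> places F \<Longrightarrow> (x, y) \<noteq> (0, 0) \<Longrightarrow> max (v (bieval global_ring id P (x, y)))
        (v (bieval global_ring id Q (x, y))) \<le> exp (C v) * max (v x) (v y) ^ d"
proof -
  obtain f g a b f' g' a' b' where fg: "a * f + b * g = 1"
      "\<And>x y. y \<noteq> 0 \<Longrightarrow> bieval global_ring id P (x, y) = y ^ d * poly f (x / y)"
      "\<And>x y. y \<noteq> 0 \<Longrightarrow> bieval global_ring id Q (x, y) = y ^ d * poly g (x / y)"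
    and fg': "a' * f' + b' * g' = 1"
      "\<And>x y. x \<noteq> 0 \<Longrightarrow> bieval global_ring id P (x, y) = x ^ d * poly f' (y / x)"
      "\<And>x y. x \<noteq> 0 \<Longrightarrow> bieval global_ring id Q (x, y) = x ^ d * poly g' (y / x)"
    by (rule coprime_forms_charts[OF assms(2-4)]) blast
  obtain C where C: "adelic F C"
    "\<And>v t. v \<in> places F \<Longrightarrow> v t \<le> 1 \<Longrightarrow> exp (- C v) \<le> max (v (poly f t)) (v (poly g t))"
    "\<And>v t. v \<in> places F \<Longrightarrow> v t \<le> 1 \<Longrightarrow> max (v (poly f t)) (v (poly g t)) \<le> exp (C v)"
    by (rule adelic_coprime_bound[OF assms(1) fg(1)]) blast
  obtain C' where C': "adelic F C'"
    "\<And>v t. v \<in> places F \<Longrightarrow> v t \<le> 1 \<Longrightarrow> exp (- C' v) \<le> max (v (poly f' t)) (v (poly g' t))"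
    "\<And>v t. v \<in> places F \<Longrightarrow> v t \<le> 1 \<Longrightarrow> max (v (poly f' t)) (v (poly g' t)) \<le> exp (C' v)"
    by (rule adelic_coprime_bound[OF assms(1) fg'(1)]) blast
  have both: "exp (- (C v + C' v)) * max (v x) (v y) ^ d
        \<le> max (v (bieval global_ring id P (x, y))) (v (bieval global_ring id Q (x, y))) \<and>
      max (v (bieval global_ring id P (x, y))) (v (bieval global_ring id Q (x, y)))
        \<le> exp (C v + C' v) * max (v x) (v y) ^ d"
    if v: "v \<in> places F" and xy: "(x, y) \<noteq> (0, 0)" for v x y
  proof -
    interpret abs_value v
      using v by (rule places_abs_value)
    have pos: "0 \<le> C v" "0 \<le> C' v"
      using adelic_nonneg C(1) C'(1) v by auto
    have "\<exists>z h k. v z = max (v x) (v y) \<and> exp (- (C v + C' v)) \<le> max (v h) (v k) \<and>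
        max (v h) (v k) \<le> exp (C v + C' v) \<and>
        bieval global_ring id P (x, y) = z ^ d * h \<and> bieval global_ring id Q (x, y) = z ^ d * k"
    proof (cases "v x \<le> v y")
      case True
      then have y: "y \<noteq> 0"
        using xy by (metis nonneg order.antisym zero_iff)
      then have t: "v (x / y) \<le> 1"
        using True by (simp add: divide)
      have "exp (- (C v + C' v)) \<le> exp (- C v)" "exp (C v) \<le> exp (C v + C' v)"
        using pos by simp_all
      then have "exp (- (C v + C' v)) \<le> max (v (poly f (x / y))) (v (poly g (x / y)))"
          "max (v (poly f (x / y))) (v (poly g (x / y))) \<le> exp (C v + C' v)"
        using C(2,3)[OF v t] by (blast intro: order.trans)+
      moreover have "v y = max (v x) (v y)"
        using True by simp
      ultimately show ?thesis
        using fg(2,3)[OF y, of x] by blast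
    next
      case False
      then have x: "x \<noteq> 0"
        using xy nonneg[of y] zero_iff[of x] by (metis nle_le)
      then have t: "v (y / x) \<le> 1"
        using False by (simp add: divide)
      have "exp (- (C v + C' v)) \<le> exp (- C' v)" "exp (C' v) \<le> exp (C v + C' v)"
        using pos by simp_all
      then have "exp (- (C v + C' v)) \<le> max (v (poly f' (y / x))) (v (poly g' (y / x)))"
          "max (v (poly f' (y / x))) (v (poly g' (y / x))) \<le> exp (C v + C' v)"
        using C'(2,3)[OF v t] by (blast intro: order.trans)+
      moreover have "v x = max (v x) (v y)"
        using False by simp
      ultimately show ?thesis
        using fg'(2,3)[OF x, of y] by blast
    qed
    then obtain z h k where z: "v z = max (v x) (v y)" and hk: "exp (- (C v + C' v)) \<le> max (v h) (v k)"
        "max (v h) (v k) \<le> exp (C v + C' v)"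
        and eq: "bieval global_ring id P (x, y) = z ^ d * h" "bieval global_ring id Q (x, y) = z ^ d * k"
      by blast
    have "max (v (bieval global_ring id P (x, y))) (v (bieval global_ring id Q (x, y)))
        = max (v h) (v k) * max (v x) (v y) ^ d"
      using max_mult_distrib_right[of "v h" "v k" "v z ^ d"]
      by (simp add: eq mult power mult.commute flip: z)
    moreover have "0 \<le> max (v x) (v y) ^ d"
      by (simp add: max.coboundedI1)
    ultimately show ?thesis
      using hk by (simp add: mult_right_mono)
  qed
  show ?thesis
  proof (rule that[of "\<lambda>v. C v + C' v"])
    show "adelic F (\<lambda>v. C v + C' v)"
      by (intro adelic_add C C')
  qed (use both in blast)+
qed

text \<open>Purely algebraic, with no place involved: it keeps orbits over K away from the origin. A
  common zero would turn a Bezout identity into 0 = 1.\<close>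

lemma coprime_forms_no_common_zero:
  assumes "homogeneous d P" "homogeneous d Q" "coprime P Q" "(x, y) \<noteq> (0, 0)"
  shows "bieval global_ring id P (x, y) \<noteq> 0 \<or> bieval global_ring id Q (x, y) \<noteq> 0"
proof -
  have no_zero: "poly f t \<noteq> 0 \<or> poly g t \<noteq> 0" if "a * f + b * g = 1" for a b f g :: "'a poly" and t
    using arg_cong[OF that, of "\<lambda>p. poly p t"] by auto
  show ?thesis
  proof (rule coprime_forms_charts[OF assms(1-3)])
    fix f g a b f' g' a' b' :: "'a poly"
    assume *: "a * f + b * g = 1" "a' * f' + b' * g' = 1"
      "\<And>x y. y \<noteq> 0 \<Longrightarrow> bieval global_ring id P (x, y) = y ^ d * poly f (x / y)"
      "\<And>x y. y \<noteq> 0 \<Longrightarrow> bieval global_ring id Q (x, y) = y ^ d * poly g (x / y)"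
      "\<And>x y. x \<noteq> 0 \<Longrightarrow> bieval global_ring id P (x, y) = x ^ d * poly f' (y / x)"
      "\<And>x y. x \<noteq> 0 \<Longrightarrow> bieval global_ring id Q (x, y) = x ^ d * poly g' (y / x)"
    show ?thesis
      using no_zero[OF *(1), of "x / y"] no_zero[OF *(2), of "y / x"] assms(4)
      by (cases "y = 0") (simp_all add: *(3-))
  qed
qed

section \<open>Completions\<close>

context abs_value
begin

abbreviation "R\<^sub>v \<equiv> cauchy_ring v"
abbreviation "K\<^sub>v \<equiv> completion_ring v"

lemma cauchy_seqs_D:
  "u \<in> cauchy_seqs v \<Longrightarrow> e > 0 \<Longrightarrow> \<exists>N. \<forall>m\<ge>N. \<forall>n\<ge>N. v (u m - u n) < e"
  by (simp add: cauchy_seqs_def)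

lemma const_cauchy [simp]: "(\<lambda>n. c) \<in> cauchy_seqs v"
  by (simp add: cauchy_seqs_def)

lemma convergent_cauchy_seq:
  assumes "u \<in> cauchy_seqs v"
  shows "convergent (\<lambda>n. v (u n))"
proof -
  have "Cauchy (\<lambda>n. v (u n))"
  proof (rule metric_CauchyI)
    fix e :: real assume "e > 0"
    then obtain N where "\<forall>m\<ge>N. \<forall>n\<ge>N. v (u m - u n) < e"
      using cauchy_seqs_D[OF assms] by blast
    then show "\<exists>M. \<forall>m\<ge>M. \<forall>n\<ge>M. dist (v (u m)) (v (u n)) < e"
      by (metis diff_ge dist_real_def order.strict_trans1)
  qed
  then show ?thesis
    by (rule Cauchy_convergent)
qed

lemma cauchy_seq_bound:
  assumes "u \<in> cauchy_seqs v"
  obtains B where "B > 0" "\<And>n. v (u n) \<le> B"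
  using convergent_imp_Bseq[OF convergent_cauchy_seq[OF assms]] by (auto simp: Bseq_def)

lemma cauchy_add:
  assumes "u \<in> cauchy_seqs v" "w \<in> cauchy_seqs v"
  shows "(\<lambda>n. u n + w n) \<in> cauchy_seqs v"
  unfolding cauchy_seqs_def
proof (intro CollectI allI impI)
  fix e :: real assume "e > 0"
  then have "e / 2 > 0"
    by simp
  then obtain M N where M: "\<forall>m\<ge>M. \<forall>n\<ge>M. v (u m - u n) < e / 2"
    and N: "\<forall>m\<ge>N. \<forall>n\<ge>N. v (w m - w n) < e / 2"
    using assms by (meson cauchy_seqs_D)
  show "\<exists>N. \<forall>m\<ge>N. \<forall>n\<ge>N. v (u m + w m - (u n + w n)) < e"
  proof (intro exI allI impI)
    fix m n assume "max M N \<le> m" "max M N \<le> n"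
    then have "v (u m - u n) < e / 2" "v (w m - w n) < e / 2"
      using M N by auto
    then show "v (u m + w m - (u n + w n)) < e"
      using triangle[of "u m - u n" "w m - w n"] by (simp add: algebra_simps)
  qed
qed

lemma cauchy_mult:
  assumes "u \<in> cauchy_seqs v" "w \<in> cauchy_seqs v"
  shows "(\<lambda>n. u n * w n) \<in> cauchy_seqs v"
  unfolding cauchy_seqs_def
proof (intro CollectI allI impI)
  obtain A where A: "A > 0" "\<And>n. v (u n) \<le> A"
    using assms(1) cauchy_seq_bound by blast
  obtain B where B: "B > 0" "\<And>n. v (w n) \<le> B"
    using assms(2) cauchy_seq_bound by blast
  fix e :: real assume "e > 0"
  then have "e / (2 * A) > 0" "e / (2 * B) > 0"
    using A B by simp_all
  then obtain M N where M: "\<forall>m\<ge>M. \<forall>n\<ge>M. v (u m - u n) < e / (2 * B)"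
    and N: "\<forall>m\<ge>N. \<forall>n\<ge>N. v (w m - w n) < e / (2 * A)"
    using assms by (meson cauchy_seqs_D)
  show "\<exists>N. \<forall>m\<ge>N. \<forall>n\<ge>N. v (u m * w m - u n * w n) < e"
  proof (intro exI allI impI)
    fix m n assume "max M N \<le> m" "max M N \<le> n"
    then have *: "v (u m - u n) < e / (2 * B)" "v (w m - w n) < e / (2 * A)"
      using M N by auto
    have "v (u m * w m - u n * w n) = v (u m * (w m - w n) + w n * (u m - u n))"
      by (simp add: algebra_simps)
    also have "\<dots> \<le> v (u m) * v (w m - w n) + v (w n) * v (u m - u n)"
      using triangle by (simp flip: mult)
    also have "\<dots> \<le> A * v (w m - w n) + B * v (u m - u n)"
      using A(2) B(2) by (intro add_mono mult_right_mono) auto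
    also have "\<dots> < A * (e / (2 * A)) + B * (e / (2 * B))"
      using * A(1) B(1) by (intro add_strict_mono mult_strict_left_mono) auto
    also have "\<dots> = e"
      using A(1) B(1) by simp
    finally show "v (u m * w m - u n * w n) < e" .
  qed
qed

lemma cauchy_minus: "u \<in> cauchy_seqs v \<Longrightarrow> (\<lambda>n. - u n) \<in> cauchy_seqs v"
  using cauchy_mult[OF const_cauchy[of "- 1"]] by simp

lemma null_add: "u \<in> null_seqs v \<Longrightarrow> w \<in> null_seqs v \<Longrightarrow> (\<lambda>n. u n + w n) \<in> null_seqs v"
  unfolding null_seqs_def
  by (rule CollectI, rule Lim_null_comparison[where g = "\<lambda>n. v (u n) + v (w n)"])
     (auto simp: triangle intro: tendsto_add_zero)

lemma null_zero: "(\<lambda>_. 0) \<in> null_seqs v"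
  by (simp add: null_seqs_def)

lemma null_minus: "u \<in> null_seqs v \<Longrightarrow> (\<lambda>n. - u n) \<in> null_seqs v"
  by (simp add: null_seqs_def)

lemma null_mult:
  assumes "u \<in> cauchy_seqs v" "w \<in> null_seqs v"
  shows "(\<lambda>n. u n * w n) \<in> null_seqs v"
proof -
  obtain L where "(\<lambda>n. v (u n)) \<longlonglongrightarrow> L"
    using convergent_cauchy_seq[OF assms(1)] by (auto simp: convergent_def)
  then have "(\<lambda>n. v (u n) * v (w n)) \<longlonglongrightarrow> L * 0"
    using assms(2) unfolding null_seqs_def by (intro tendsto_mult) auto
  then show ?thesis
    by (simp add: null_seqs_def mult)
qed

lemma null_imp_cauchy: "u \<in> null_seqs v \<Longrightarrow> u \<in> cauchy_seqs v"
  unfolding cauchy_seqs_def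
proof (intro CollectI allI impI)
  fix e :: real assume u: "u \<in> null_seqs v" and "e > 0"
  then have "e / 2 > 0"
    by simp
  then obtain N where N: "\<And>n. n \<ge> N \<Longrightarrow> v (u n) < e / 2"
    using order_tendstoD(2)[of "\<lambda>n. v (u n)" 0 sequentially "e / 2"] u
    unfolding null_seqs_def eventually_sequentially by auto
  show "\<exists>N. \<forall>m\<ge>N. \<forall>n\<ge>N. v (u m - u n) < e"
  proof (intro exI allI impI)
    fix m n assume "N \<le> m" "N \<le> n"
    then show "v (u m - u n) < e"
      using N[of m] N[of n] triangle[of "u m" "- u n"] by simp
  qed
qed

section \<open>The completion as a quotient ring and its absolute value\<close>

lemma cauchy_ring_simps [simp]:
  "carrier R\<^sub>v = cauchy_seqs v"
  "u \<otimes>\<^bsub>R\<^sub>v\<^esub> w = (\<lambda>n. u n * w n)"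
  "u \<oplus>\<^bsub>R\<^sub>v\<^esub> w = (\<lambda>n. u n + w n)"
  "\<zero>\<^bsub>R\<^sub>v\<^esub> = (\<lambda>n. 0)"
  "\<one>\<^bsub>R\<^sub>v\<^esub> = (\<lambda>n. 1)"
  by (simp_all add: cauchy_ring_def)

lemma cauchy_ring_cring: "cring R\<^sub>v"
proof (rule cringI)
  show "abelian_group R\<^sub>v"
  proof (rule abelian_groupI)
    fix u assume "u \<in> carrier R\<^sub>v"
    then show "\<exists>w\<in>carrier R\<^sub>v. w \<oplus>\<^bsub>R\<^sub>v\<^esub> u = \<zero>\<^bsub>R\<^sub>v\<^esub>"
      by (intro bexI[of _ "\<lambda>n. - u n"]) (simp_all add: cauchy_minus)
  qed (auto simp: cauchy_add algebra_simps)
  show "Group.comm_monoid R\<^sub>v"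
    by (rule comm_monoidI) (auto simp: cauchy_mult algebra_simps)
qed (simp add: algebra_simps)

lemma null_ideal: "ideal (null_seqs v) R\<^sub>v"
proof (rule idealI)
  show "ring R\<^sub>v"
    using cauchy_ring_cring by (rule cring.axioms)
  interpret cring R\<^sub>v
    by (rule cauchy_ring_cring)
  have inv: "\<ominus>\<^bsub>R\<^sub>v\<^esub> u = (\<lambda>n. - u n)" if "u \<in> cauchy_seqs v" for u
    using that by (intro sum_zero_eq_neg[symmetric]) (auto simp: cauchy_minus)
  show "subgroup (null_seqs v) (add_monoid R\<^sub>v)"
  proof (rule add.subgroupI)
    show "null_seqs v \<noteq> {}"
      using null_zero by blast
    show "u \<in> null_seqs v \<Longrightarrow> \<ominus>\<^bsub>R\<^sub>v\<^esub> u \<in> null_seqs v" for u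
      by (simp add: inv null_imp_cauchy null_minus)
  qed (auto simp: null_imp_cauchy null_add)
  show "w \<otimes>\<^bsub>R\<^sub>v\<^esub> u \<in> null_seqs v" "u \<otimes>\<^bsub>R\<^sub>v\<^esub> w \<in> null_seqs v"
    if "u \<in> null_seqs v" "w \<in> carrier R\<^sub>v" for u w
    using null_mult[of w u] that by (simp_all add: mult.commute)
qed

text \<open>Only the commutative ring structure is taken from the quotient. Zero divisors are
  excluded later, in \<open>completion_mult_nonzero\<close>, by the multiplicative absolute value,
  without inverting Cauchy sequences.\<close>

lemma completion_hom: "ring_hom_cring R\<^sub>v K\<^sub>v (seq_class v)"
  using ideal.rcos_ring_hom_cring[OF null_ideal cauchy_ring_cring]
  by (simp add: completion_ring_def seq_class_def[abs_def])

lemma completion_cring: "cring K\<^sub>v"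
  using completion_hom by (rule ring_hom_cring.axioms)

lemma completion_carrier: "carrier K\<^sub>v = seq_class v ` cauchy_seqs v"
  by (auto simp: completion_ring_def FactRing_def A_RCOSETS_def' seq_class_def)

lemma seq_class_closed [simp]: "u \<in> cauchy_seqs v \<Longrightarrow> seq_class v u \<in> carrier K\<^sub>v"
  by (simp add: completion_carrier)

lemma completion_elim:
  assumes "\<xi> \<in> carrier K\<^sub>v"
  obtains u where "u \<in> cauchy_seqs v" "\<xi> = seq_class v u"
  using assms by (auto simp: completion_carrier)

lemma seq_class_mem: "w \<in> seq_class v u \<longleftrightarrow> (\<exists>h\<in>null_seqs v. w = (\<lambda>n. h n + u n))"
  by (auto simp: seq_class_def a_r_coset_def')

text \<open>\<open>completion_abs\<close> is defined through an arbitrary representative. Any other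
  one differs from it by a null sequence, so by the reverse triangle inequality the limits agree,
  and from here on every representative is as good as the chosen one.\<close>

lemma completion_abs_tendsto:
  assumes "u \<in> cauchy_seqs v"
  shows "(\<lambda>n. v (u n)) \<longlonglongrightarrow> completion_abs v (seq_class v u)"
proof -
  define w where "w = (SOME w. w \<in> seq_class v u)"
  have "u \<in> seq_class v u"
    unfolding seq_class_mem using null_zero by force
  then have "w \<in> seq_class v u"
    unfolding w_def by (rule someI[where P = "\<lambda>w. w \<in> seq_class v u"])
  then obtain h where h: "h \<in> null_seqs v" "w = (\<lambda>n. h n + u n)"
    by (auto simp: seq_class_mem)
  obtain L where L: "(\<lambda>n. v (u n)) \<longlonglongrightarrow> L"
    using convergent_cauchy_seq[OF assms] by (auto simp: convergent_def)
  have "(\<lambda>n. v (w n) - v (u n)) \<longlonglongrightarrow> 0"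
  proof (rule Lim_null_comparison[OF always_eventually])
    show "\<forall>n. norm (v (w n) - v (u n)) \<le> v (h n)"
      by (metis diff_ge real_norm_def h(2) add_diff_cancel_right')
    show "(\<lambda>n. v (h n)) \<longlonglongrightarrow> 0"
      using h(1) by (simp add: null_seqs_def)
  qed
  then have "(\<lambda>n. v (w n)) \<longlonglongrightarrow> L"
    using tendsto_add[OF _ L] by force
  then have "completion_abs v (seq_class v u) = L"
    unfolding completion_abs_def w_def by (rule limI)
  then show ?thesis
    using L by simp
qed

lemma completion_abs_unique:
  "u \<in> cauchy_seqs v \<Longrightarrow> (\<lambda>n. v (u n)) \<longlonglongrightarrow> L \<Longrightarrow> completion_abs v (seq_class v u) = L"
  using completion_abs_tendsto by (rule LIMSEQ_unique)

lemma completion_abs_nonneg: "\<xi> \<in> carrier K\<^sub>v \<Longrightarrow> 0 \<le> completion_abs v \<xi>"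
  by (elim completion_elim) (auto intro!: LIMSEQ_le_const[OF completion_abs_tendsto])

lemma seq_class_mult:
  "u \<in> cauchy_seqs v \<Longrightarrow> w \<in> cauchy_seqs v \<Longrightarrow>
    seq_class v u \<otimes>\<^bsub>K\<^sub>v\<^esub> seq_class v w = seq_class v (\<lambda>n. u n * w n)"
  using ring_hom_mult[OF ring_hom_cring.homh[OF completion_hom], of u w] by simp

lemma seq_class_zero: "\<zero>\<^bsub>K\<^sub>v\<^esub> = seq_class v (\<lambda>_. 0)"
  using ring_hom_cring.hom_zero[OF completion_hom] by simp

lemma seq_class_one: "\<one>\<^bsub>K\<^sub>v\<^esub> = seq_class v (\<lambda>_. 1)"
  using ring_hom_one[OF ring_hom_cring.homh[OF completion_hom]] by simp

lemma completion_abs_mult: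
  assumes "\<xi> \<in> carrier K\<^sub>v" "\<eta> \<in> carrier K\<^sub>v"
  shows "completion_abs v (\<xi> \<otimes>\<^bsub>K\<^sub>v\<^esub> \<eta>) = completion_abs v \<xi> * completion_abs v \<eta>"
proof -
  obtain u where u: "u \<in> cauchy_seqs v" "\<xi> = seq_class v u"
    using assms(1) by (rule completion_elim)
  obtain w where w: "w \<in> cauchy_seqs v" "\<eta> = seq_class v w"
    using assms(2) by (rule completion_elim)
  have "(\<lambda>n. v (u n * w n)) \<longlonglongrightarrow> completion_abs v \<xi> * completion_abs v \<eta>"
    unfolding mult u(2) w(2) by (intro tendsto_mult completion_abs_tendsto u w)
  then show ?thesis
    unfolding u(2) w(2) seq_class_mult[OF u(1) w(1)]
    by (intro completion_abs_unique cauchy_mult u w)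
qed

lemma completion_abs_zero_iff:
  assumes "\<xi> \<in> carrier K\<^sub>v"
  shows "completion_abs v \<xi> = 0 \<longleftrightarrow> \<xi> = \<zero>\<^bsub>K\<^sub>v\<^esub>"
proof -
  obtain u where u: "u \<in> cauchy_seqs v" "\<xi> = seq_class v u"
    using assms by (rule completion_elim)
  have "completion_abs v \<xi> = 0 \<longleftrightarrow> u \<in> null_seqs v"
  proof
    show "completion_abs v \<xi> = 0 \<Longrightarrow> u \<in> null_seqs v"
      using completion_abs_tendsto[OF u(1)] by (simp add: null_seqs_def u(2))
    show "u \<in> null_seqs v \<Longrightarrow> completion_abs v \<xi> = 0"
      unfolding u(2) using u(1) by (rule completion_abs_unique) (simp add: null_seqs_def)
  qed
  also have "\<dots> \<longleftrightarrow> seq_class v u = seq_class v (\<lambda>_. 0)"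
  proof
    assume *: "u \<in> null_seqs v"
    have "seq_class v u = null_seqs v"
      unfolding seq_class_def
      by (rule abelian_subgroup.a_rcos_const[OF abelian_subgroupI3 *])
         (use null_ideal cauchy_ring_cring in \<open>auto simp: ideal_def additive_subgroup_def cring_def ring_def\<close>)
    moreover have "seq_class v (\<lambda>_. 0) = null_seqs v"
      by (auto simp: seq_class_mem)
    ultimately show "seq_class v u = seq_class v (\<lambda>_. 0)"
      by simp
  next
    assume *: "seq_class v u = seq_class v (\<lambda>_. 0)"
    have "u \<in> seq_class v u"
      unfolding seq_class_mem using null_zero by force
    then show "u \<in> null_seqs v"
      unfolding * by (auto simp: seq_class_mem)
  qed
  finally show ?thesis
    by (simp add: u(2) seq_class_zero)
qed

lemma completion_abs_pos:
  "\<xi> \<in> carrier K\<^sub>v \<Longrightarrow> 0 < completion_abs v \<xi> \<longleftrightarrow> \<xi> \<noteq> \<zero>\<^bsub>K\<^sub>v\<^esub>"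
  using completion_abs_zero_iff completion_abs_nonneg by (metis order.order_iff_strict order.strict_iff_not)

section \<open>Forms over the completion\<close>

lemma completion_embed_closed [simp]: "completion_embed v c \<in> carrier K\<^sub>v"
  by (simp add: completion_embed_def)

lemma completion_abs_embed [simp]: "completion_abs v (completion_embed v c) = v c"
  unfolding completion_embed_def by (rule completion_abs_unique) auto

lemma cauchy_power: "u \<in> cauchy_seqs v \<Longrightarrow> (\<lambda>n. u n ^ k) \<in> cauchy_seqs v"
  by (induction k) (auto intro: cauchy_mult)

lemma seq_class_power:
  assumes "u \<in> cauchy_seqs v"
  shows "seq_class v u [^]\<^bsub>K\<^sub>v\<^esub> (k::nat) = seq_class v (\<lambda>n. u n ^ k)"
proof -
  interpret cring K\<^sub>v
    by (rule completion_cring)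
  show ?thesis
    using assms
    by (induction k) (simp_all add: seq_class_one seq_class_mult cauchy_power mult.commute)
qed

lemma cauchy_ring_finsum:
  assumes "finite A" "\<And>k. k \<in> A \<Longrightarrow> f k \<in> cauchy_seqs v"
  shows "finsum R\<^sub>v f A = (\<lambda>n. \<Sum>k\<in>A. f k n)"
proof -
  interpret cring R\<^sub>v
    by (rule cauchy_ring_cring)
  show ?thesis
    using assms
  proof (induction A)
    case (insert k A)
    then have "finsum R\<^sub>v f (insert k A) = f k \<oplus>\<^bsub>R\<^sub>v\<^esub> finsum R\<^sub>v f A"
      by (intro finsum_insert) auto
    with insert show ?case
      by simp
  qed simp
qed

text \<open>Evaluation commutes with passing to classes because \<open>seq_class v\<close> is a ring
  homomorphism and coefficients embed as constant sequences. This reduces statements on forms over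
  K_v to termwise statements over K.\<close>

lemma cauchy_bieval:
  assumes "u \<in> cauchy_seqs v" "w \<in> cauchy_seqs v"
  shows "(\<lambda>n. bieval global_ring id G (u n, w n)) \<in> cauchy_seqs v"
    and "bieval K\<^sub>v (completion_embed v) G (seq_class v u, seq_class v w)
      = seq_class v (\<lambda>n. bieval global_ring id G (u n, w n))"
proof -
  interpret ring_hom_cring R\<^sub>v K\<^sub>v "seq_class v"
    by (rule completion_hom)
  define t where "t k = (\<lambda>n. poly.coeff (poly.coeff G (fst k)) (snd k) * (u n ^ fst k * w n ^ snd k))" for k
  have t: "t k \<in> cauchy_seqs v" for k
    unfolding t_def by (intro cauchy_mult cauchy_power const_cauchy assms)
  have eq: "(\<lambda>n. bieval global_ring id G (u n, w n)) = finsum R\<^sub>v t (bisupport G)"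
    by (subst cauchy_ring_finsum[OF finite_bisupport t])
       (simp add: finite_bisupport bieval_def t_def)
  show "(\<lambda>n. bieval global_ring id G (u n, w n)) \<in> cauchy_seqs v"
    unfolding eq using R.finsum_closed[of t "bisupport G"] t by auto
  have "seq_class v (\<lambda>n. bieval global_ring id G (u n, w n))
      = finsum K\<^sub>v (seq_class v \<circ> t) (bisupport G)"
    unfolding eq by (rule hom_finsum) (use t in auto)
  also have "\<dots> = bieval K\<^sub>v (completion_embed v) G (seq_class v u, seq_class v w)"
    unfolding bieval_def
  proof (rule S.finsum_cong')
    fix k
    show "(seq_class v \<circ> t) k = completion_embed v (poly.coeff (poly.coeff G (fst k)) (snd k)) \<otimes>\<^bsub>K\<^sub>v\<^esub>
        (fst (seq_class v u, seq_class v w) [^]\<^bsub>K\<^sub>v\<^esub> fst k \<otimes>\<^bsub>K\<^sub>v\<^esub>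
         snd (seq_class v u, seq_class v w) [^]\<^bsub>K\<^sub>v\<^esub> snd k)"
      using assms
      by (simp add: t_def completion_embed_def seq_class_mult cauchy_mult cauchy_power seq_class_power)
  qed (use assms in auto)
  finally show "bieval K\<^sub>v (completion_embed v) G (seq_class v u, seq_class v w)
      = seq_class v (\<lambda>n. bieval global_ring id G (u n, w n))"
    by simp
qed

lemma bieval_closed:
  "\<lbrakk>fst p \<in> carrier K\<^sub>v; snd p \<in> carrier K\<^sub>v\<rbrakk> \<Longrightarrow> bieval K\<^sub>v (completion_embed v) G p \<in> carrier K\<^sub>v"
  by (cases p, simp, elim completion_elim) (simp add: cauchy_bieval)

lemma bieval_embed:
  "bieval K\<^sub>v (completion_embed v) G (completion_embed v x, completion_embed v y)
    = completion_embed v (bieval global_ring id G (x, y))"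
  unfolding completion_embed_def[of v x] completion_embed_def[of v y]
  by (simp add: cauchy_bieval(2)) (simp add: completion_embed_def)

lemma bieval_completion_scale:
  assumes "homogeneous d G" "c \<in> carrier K\<^sub>v" "\<xi> \<in> carrier K\<^sub>v" "\<eta> \<in> carrier K\<^sub>v"
  shows "bieval K\<^sub>v (completion_embed v) G (c \<otimes>\<^bsub>K\<^sub>v\<^esub> \<xi>, c \<otimes>\<^bsub>K\<^sub>v\<^esub> \<eta>)
    = c [^]\<^bsub>K\<^sub>v\<^esub> d \<otimes>\<^bsub>K\<^sub>v\<^esub> bieval K\<^sub>v (completion_embed v) G (\<xi>, \<eta>)"
proof -
  obtain z where z: "z \<in> cauchy_seqs v" "c = seq_class v z"
    using assms(2) by (rule completion_elim)
  obtain u where u: "u \<in> cauchy_seqs v" "\<xi> = seq_class v u"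
    using assms(3) by (rule completion_elim)
  obtain w where w: "w \<in> cauchy_seqs v" "\<eta> = seq_class v w"
    using assms(4) by (rule completion_elim)
  from z u w show ?thesis
    by (simp add: seq_class_power seq_class_mult cauchy_mult cauchy_power cauchy_bieval
        bieval_homogeneous_scale[OF assms(1)])
qed

lemma lift_map_bound:
  assumes hom: "homogeneous d (fst L)" "homogeneous d (snd L)" "d > 0"
    and bound: "\<And>x y. (x, y) \<noteq> (0, 0) \<Longrightarrow> a * max (v x) (v y) ^ d
        \<le> max (v (bieval global_ring id (fst L) (x, y))) (v (bieval global_ring id (snd L) (x, y)))"
      "\<And>x y. (x, y) \<noteq> (0, 0) \<Longrightarrow> max (v (bieval global_ring id (fst L) (x, y)))
        (v (bieval global_ring id (snd L) (x, y))) \<le> b * max (v x) (v y) ^ d"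
    and p: "p \<in> carrier K\<^sub>v \<times> carrier K\<^sub>v"
  shows "a * local_norm v p ^ d \<le> local_norm v (lift_map K\<^sub>v (completion_embed v) L p)"
    and "local_norm v (lift_map K\<^sub>v (completion_embed v) L p) \<le> b * local_norm v p ^ d"
proof -
  obtain u w where uw: "u \<in> cauchy_seqs v" "w \<in> cauchy_seqs v" "p = (seq_class v u, seq_class v w)"
    using p by (metis SigmaE completion_elim)
  let ?M = "\<lambda>n. max (v (u n)) (v (w n))"
  let ?N = "\<lambda>n. max (v (bieval global_ring id (fst L) (u n, w n)))
      (v (bieval global_ring id (snd L) (u n, w n)))"
  have zero: "bieval global_ring id G (0, 0) = 0" if "homogeneous d G" for G :: "'a bipoly"
    using bieval_homogeneous_scale[OF that, of 0 0 0] hom(3) by (simp add: zero_power)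
  have M: "?M \<longlonglongrightarrow> local_norm v p"
    unfolding local_norm_def uw by (auto intro!: tendsto_max completion_abs_tendsto uw)
  have N: "?N \<longlonglongrightarrow> local_norm v (lift_map K\<^sub>v (completion_embed v) L p)"
    unfolding local_norm_def lift_map_def uw
    by (auto intro!: tendsto_max completion_abs_tendsto cauchy_bieval uw simp: cauchy_bieval(2)[OF uw(1,2)])
  \<comment> \<open>A representing sequence may pass through the origin, where \<open>bound\<close>
    is silent; both sides are then 0 because d > 0. Being weak, the inequalities survive the
    limit.\<close>
  have "a * ?M n ^ d \<le> ?N n \<and> ?N n \<le> b * ?M n ^ d" for n
  proof (cases "(u n, w n) = (0, 0)")
    case True
    then have "?M n = 0" "?N n = 0"
      using zero[OF hom(1)] zero[OF hom(2)] by auto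
    then show ?thesis
      using hom(3) by (simp add: zero_power)
  next
    case False
    show ?thesis
      using bound[OF False] by blast
  qed
  then have *: "\<And>n. a * ?M n ^ d \<le> ?N n" "\<And>n. ?N n \<le> b * ?M n ^ d"
    by blast+
  show "a * local_norm v p ^ d \<le> local_norm v (lift_map K\<^sub>v (completion_embed v) L p)"
      "local_norm v (lift_map K\<^sub>v (completion_embed v) L p) \<le> b * local_norm v p ^ d"
    by (rule LIMSEQ_le[OF tendsto_mult[OF tendsto_const tendsto_power[OF M]] N] exI allI impI *
        LIMSEQ_le[OF N tendsto_mult[OF tendsto_const tendsto_power[OF M]]])+
qed

end

section \<open>Limits and integrals\<close>

text \<open>After taking logarithms and dividing by D n, consecutive terms differ by at most C / D
  (Suc n), and D n is at least 2^n. The exponents enter only through being at least 2, so the rate C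
  / 2^n is common to all sequences of degrees.\<close>

lemma escape_rate:
  fixes N :: "nat \<Rightarrow> real" and d :: "nat \<Rightarrow> nat"
  assumes C: "0 \<le> C" and N0: "0 < N 0"
    and d: "\<And>n. 2 \<le> d (Suc n)"
    and lower: "\<And>n. exp (- C) * N n ^ d (Suc n) \<le> N (Suc n)"
    and upper: "\<And>n. N (Suc n) \<le> exp C * N n ^ d (Suc n)"
  defines "D \<equiv> \<lambda>n. real (\<Prod>i\<in>{1..n}. d i)"
  shows "0 < N n"
    and "(\<lambda>n. ln (N n) / D n) \<longlonglongrightarrow> lim (\<lambda>n. ln (N n) / D n)"
    and "\<bar>lim (\<lambda>n. ln (N n) / D n) - ln (N n) / D n\<bar> \<le> C / 2 ^ n"
proof -
  have pos: "0 < N n" for n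
  proof (induction n)
    case (Suc n)
    then have "0 < exp (- C) * N n ^ d (Suc n)"
      by simp
    then show ?case
      using lower[of n] by (rule less_le_trans)
  qed (rule N0)
  then show "0 < N n" .
  have D_Suc: "D (Suc n) = real (d (Suc n)) * D n" for n
    by (simp add: D_def)
  have D: "2 ^ n \<le> D n" for n
  proof (induction n)
    case (Suc n)
    have "2 * 2 ^ n \<le> real (d (Suc n)) * D n"
      using d[of n] Suc by (intro mult_mono) auto
    then show ?case
      by (simp only: D_Suc power_Suc)
  qed (simp add: D_def)
  have D_pos: "0 < D n" for n
    using D[of n] by (meson less_le_trans zero_less_numeral zero_less_power)
  define a where "a = (\<lambda>n. ln (N n) / D n)"
  have step: "\<bar>a (Suc n) - a n\<bar> \<le> C / 2 ^ Suc n" for n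
  proof -
    have "ln (exp (- C) * N n ^ d (Suc n)) \<le> ln (N (Suc n))"
      using lower[of n] pos[of n] by (intro ln_mono) auto
    moreover have "ln (N (Suc n)) \<le> ln (exp C * N n ^ d (Suc n))"
      using upper[of n] pos by (intro ln_mono) auto
    ultimately have *: "\<bar>ln (N (Suc n)) - real (d (Suc n)) * ln (N n)\<bar> \<le> C"
      using pos[of n] by (simp add: ln_mult ln_realpow abs_le_iff)
    have "real (d (Suc n)) \<noteq> 0"
      using d[of n] by simp
    then have "a (Suc n) - a n = (ln (N (Suc n)) - real (d (Suc n)) * ln (N n)) / D (Suc n)"
      using D_pos[of n] by (simp add: a_def D_Suc field_simps)
    then have "\<bar>a (Suc n) - a n\<bar> = \<bar>ln (N (Suc n)) - real (d (Suc n)) * ln (N n)\<bar> / D (Suc n)"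
      using D_pos[of "Suc n"] by (simp add: abs_divide)
    also have "\<dots> \<le> C / 2 ^ Suc n"
      using * D[of "Suc n"] by (intro frac_le) auto
    finally show ?thesis .
  qed
  \<comment> \<open>Keeping the subtracted term lets the induction close: it shrinks from C / 2^(n +
    k) to C / 2^(n + k + 1), which pays exactly for the next step.\<close>
  have tail: "\<bar>a (n + k) - a n\<bar> \<le> C / 2 ^ n - C / 2 ^ (n + k)" for n k
  proof (induction k)
    case (Suc k)
    then show ?case
      using step[of "n + k"] by simp
  qed simp
  have bound: "\<bar>a m - a n\<bar> \<le> C / 2 ^ n" if "n \<le> m" for m n
  proof -
    have "0 \<le> C / 2 ^ m"
      using C by simp
    then show ?thesis
      using tail[of n "m - n"] that by simp
  qed
  have "Cauchy a"
  proof (rule CauchyI')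
    fix e :: real assume "0 < e"
    have "(\<lambda>n. C / 2 ^ n) \<longlonglongrightarrow> 0"
      using tendsto_mult[OF tendsto_const LIMSEQ_power_zero[of "1 / 2 :: real"], of C]
      by (simp add: power_divide)
    then obtain M where "\<bar>C / 2 ^ M\<bar> < e"
      using \<open>0 < e\<close> by (auto simp: LIMSEQ_iff)
    then show "\<exists>M. \<forall>m\<ge>M. \<forall>n>m. dist (a m) (a n) < e"
    proof (intro exI allI impI)
      fix m n assume "M \<le> m" "m < n"
      have "\<bar>a n - a m\<bar> \<le> C / 2 ^ m"
        using \<open>m < n\<close> by (intro bound) simp
      also have "\<dots> \<le> C / 2 ^ M"
        using \<open>M \<le> m\<close> C by (intro divide_left_mono power_increasing) auto
      also have "\<dots> < e"
        using \<open>\<bar>C / 2 ^ M\<bar> < e\<close> by linarith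
      finally show "dist (a m) (a n) < e"
        by (simp add: dist_real_def abs_minus_commute)
    qed
  qed
  then have lim: "a \<longlonglongrightarrow> lim a"
    by (simp add: Cauchy_convergent_iff convergent_LIMSEQ_iff)
  then show "(\<lambda>n. ln (N n) / D n) \<longlonglongrightarrow> lim (\<lambda>n. ln (N n) / D n)"
    by (simp add: a_def)
  have "(\<lambda>m. \<bar>a m - a n\<bar>) \<longlonglongrightarrow> \<bar>lim a - a n\<bar>"
    by (intro tendsto_intros lim)
  then have "\<bar>lim a - a n\<bar> \<le> C / 2 ^ n"
    using bound by (intro LIMSEQ_le_const2) auto
  then show "\<bar>lim (\<lambda>n. ln (N n) / D n) - ln (N n) / D n\<bar> \<le> C / 2 ^ n"
    by (simp add: a_def)
qed

text \<open>The sums are limits over finite subsets of an index set not assumed countable, so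
  dominated convergence for sequences does not apply directly. Instead the tail of the sum is
  bounded uniformly in x by the tail of B, and total mass 1 carries this bound over to the
  integrals.\<close>

lemma (in prob_space) has_sum_integral:
  fixes f :: "'i \<Rightarrow> 'a \<Rightarrow> real"
  assumes f: "\<And>i. i \<in> I \<Longrightarrow> f i \<in> borel_measurable M"
    and bound: "\<And>i x. i \<in> I \<Longrightarrow> x \<in> space M \<Longrightarrow> \<bar>f i x\<bar> \<le> B i"
    and B: "B summable_on I"
    and g: "g \<in> borel_measurable M" "\<And>x. x \<in> space M \<Longrightarrow> ((\<lambda>i. f i x) has_sum g x) I"
  shows "integrable M g" and "((\<lambda>i. \<integral>x. f i x \<partial>M) has_sum (\<integral>x. g x \<partial>M)) I"
proof -
  have tail: "\<bar>g x - (\<Sum>i\<in>A. f i x)\<bar> \<le> infsum B I - sum B A"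
    if "finite A" "A \<subseteq> I" "x \<in> space M" for A x
  proof -
    have "((\<lambda>i. f i x) has_sum (g x - (\<Sum>i\<in>A. f i x))) (I - A)"
      using that by (intro has_sum_Diff g has_sum_finite) auto
    moreover have "(B has_sum (infsum B I - sum B A)) (I - A)"
      using that B by (intro has_sum_Diff has_sum_infsum has_sum_finite) auto
    moreover have "norm (f i x) \<le> B i" if "i \<in> I - A" for i
      using bound[of i x] that \<open>x \<in> space M\<close> by simp
    ultimately have "norm (g x - (\<Sum>i\<in>A. f i x)) \<le> infsum B I - sum B A"
      by (rule norm_infsum_le)
    then show ?thesis
      by simp
  qed
  have int_f: "integrable M (f i)" if "i \<in> I" for i
    using f[OF that] bound[OF that] by (intro integrable_const_bound[of _ "B i"]) auto
  \<comment> \<open>The empty partial sum gives |g x| \<le> \<open>infsum B I\<close>.\<close>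
  show int_g: "integrable M g"
    using g(1) tail[of "{}"] by (intro integrable_const_bound[of _ "infsum B I"]) auto
  have "((\<lambda>A. sum (\<lambda>i. \<integral>x. f i x \<partial>M) A - (\<integral>x. g x \<partial>M)) \<longlongrightarrow> 0) (finite_subsets_at_top I)"
  proof (rule Lim_null_comparison)
    show "((\<lambda>A. infsum B I - sum B A) \<longlongrightarrow> 0) (finite_subsets_at_top I)"
      using tendsto_diff[OF tendsto_const has_sum_infsum[OF B, unfolded has_sum_def], of "infsum B I"]
      by simp
    show "\<forall>\<^sub>F A in finite_subsets_at_top I.
        norm (sum (\<lambda>i. \<integral>x. f i x \<partial>M) A - (\<integral>x. g x \<partial>M)) \<le> infsum B I - sum B A"
    proof (rule eventually_finite_subsets_at_top_weakI)
      fix A assume A: "finite A" "A \<subseteq> I"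
      have int_A: "integrable M (\<lambda>x. \<Sum>i\<in>A. f i x)"
        using A int_f by (intro Bochner_Integration.integrable_sum) auto
      have "norm (sum (\<lambda>i. \<integral>x. f i x \<partial>M) A - (\<integral>x. g x \<partial>M)) = norm (\<integral>x. g x - (\<Sum>i\<in>A. f i x) \<partial>M)"
        using A int_f int_A int_g
        by (subst Bochner_Integration.integral_diff, simp, simp, subst Bochner_Integration.integral_sum)
           (auto simp: abs_minus_commute)
      also have "\<dots> \<le> (\<integral>x. norm (g x - (\<Sum>i\<in>A. f i x)) \<partial>M)"
        by (rule integral_norm_bound)
      also have "\<dots> \<le> (\<integral>x. infsum B I - sum B A \<partial>M)"
        using A int_A int_g tail by (intro integral_mono) auto
      finally show "norm (sum (\<lambda>i. \<integral>x. f i x \<partial>M) A - (\<integral>x. g x \<partial>M)) \<le> infsum B I - sum B A"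
        by (simp add: prob_space)
    qed
  qed
  then show "((\<lambda>i. \<integral>x. f i x \<partial>M) has_sum (\<integral>x. g x \<partial>M)) I"
    unfolding has_sum_def by (simp add: LIM_zero_iff)
qed

lemma prob_space_sequence_measure: "prob_space \<nu> \<Longrightarrow> prob_space (sequence_measure \<nu>)"
  unfolding sequence_measure_def by (rule prob_space_PiM)

text \<open>A finite product of finite discrete spaces is discrete, so every function on it is
  measurable. The hypothesis on h ranges over all sequences because
  \<open>restrict \<gamma> {1..n}\<close> may lie outside the space.\<close>

lemma measurable_sequence_measure_finite:
  fixes h :: "(nat \<Rightarrow> 'b) \<Rightarrow> real"
  assumes \<nu>: "finite (space \<nu>)" "sets \<nu> = Pow (space \<nu>)"
    and h: "\<And>\<gamma> \<gamma>'. (\<And>i. i \<in> {1..n} \<Longrightarrow> \<gamma> i = \<gamma>' i) \<Longrightarrow> h \<gamma> = h \<gamma>'"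
  shows "h \<in> borel_measurable (sequence_measure \<nu>)"
proof -
  have "sets (\<Pi>\<^sub>M i\<in>{1..n}. \<nu>) = sets (\<Pi>\<^sub>M i\<in>{1..n}. count_space (space \<nu>))"
    using \<nu> by (intro sets_PiM_cong) auto
  also have "\<dots> = sets (count_space (PiE {1..n} (\<lambda>_. space \<nu>)))"
    using \<nu> by (simp add: count_space_PiM_finite countable_finite)
  finally have "measurable (\<Pi>\<^sub>M i\<in>{1..n}. \<nu>) borel
      = measurable (count_space (PiE {1..n} (\<lambda>_. space \<nu>))) (borel :: real measure)"
    by (rule measurable_cong_sets) simp
  then have "h \<in> borel_measurable (\<Pi>\<^sub>M i\<in>{1..n}. \<nu>)"
    by simp
  moreover have "(\<lambda>\<gamma>. restrict \<gamma> {1..n}) \<in> sequence_measure \<nu> \<rightarrow>\<^sub>M (\<Pi>\<^sub>M i\<in>{1..n}. \<nu>)"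
    unfolding sequence_measure_def by (rule measurable_restrict_subset) auto
  ultimately have "(\<lambda>\<gamma>. h (restrict \<gamma> {1..n})) \<in> borel_measurable (sequence_measure \<nu>)"
    by (rule measurable_compose_rev)
  moreover have "h (restrict \<gamma> {1..n}) = h \<gamma>" for \<gamma>
    by (rule h) simp
  ultimately show ?thesis
    by simp
qed

section \<open>Random iteration\<close>

lemma compose_upto_cong:
  "(\<And>i. i \<in> {1..n} \<Longrightarrow> T i = T' i) \<Longrightarrow> compose_upto T n = compose_upto T' n"
  by (induction n) auto

lemma adelic_summable:
  assumes "adelic F B" "\<And>v. v \<in> places F \<Longrightarrow> \<bar>f v\<bar> \<le> B v"
  shows "(\<lambda>v. local_degree F v * f v) summable_on places F"
proof -
  have "(\<lambda>v. norm (local_degree F v * f v)) summable_on places F"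
  proof (rule Infinite_Sum.abs_summable_on_comparison_test')
    show "(\<lambda>v. local_degree F v * B v) summable_on places F"
      using assms(1) by (simp add: adelic_def)
  qed (use assms(2) in \<open>simp add: abs_mult mult_left_mono\<close>)
  then show ?thesis
    by (rule abs_summable_summable)
qed

lemma has_sum_minus:
  fixes f g :: "'i \<Rightarrow> real"
  shows "(f has_sum a) A \<Longrightarrow> (g has_sum b) A \<Longrightarrow> ((\<lambda>i. f i - g i) has_sum (a - b)) A"
  unfolding has_sum_def sum_subtractf by (rule tendsto_diff)

text \<open>Crude, but each logarithm on the right is summable over the places by itself.\<close>

lemma abs_ln_max_le: "\<bar>ln (max a b)\<bar> \<le> \<bar>ln a\<bar> + \<bar>ln (b::real)\<bar>"
  by (simp add: max_def)

text \<open>Membership, that is a nonzero scalar, is all that is known of the choice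
  \<open>coords\<close>; later formulas have to absorb this scalar. The hypothesis on the unit makes
  the point a nonempty set.\<close>

lemma coords_proj_point:
  assumes "\<one>\<^bsub>R\<^esub> \<in> carrier R - {\<zero>\<^bsub>R\<^esub>}"
  obtains c where "c \<in> carrier R - {\<zero>\<^bsub>R\<^esub>}"
    "coords (proj_point R p) = (c \<otimes>\<^bsub>R\<^esub> fst p, c \<otimes>\<^bsub>R\<^esub> snd p)"
proof -
  have "(\<one>\<^bsub>R\<^esub> \<otimes>\<^bsub>R\<^esub> fst p, \<one>\<^bsub>R\<^esub> \<otimes>\<^bsub>R\<^esub> snd p) \<in> proj_point R p"
    using assms unfolding proj_point_def by blast
  then have "coords (proj_point R p) \<in> proj_point R p"
    unfolding coords_def by (rule someI)
  then show ?thesis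
    using that unfolding proj_point_def by blast
qed

lemma proj_point_scale:
  fixes c :: "'a::field"
  assumes "c \<noteq> 0"
  shows "proj_point global_ring (c * x, c * y) = proj_point global_ring (x, y)"
proof (intro Set.set_eqI iffI)
  fix r assume "r \<in> proj_point global_ring (c * x, c * y)"
  then obtain b where "b \<noteq> 0" "r = ((b * c) * x, (b * c) * y)"
    by (auto simp: proj_point_def mult.assoc)
  then show "r \<in> proj_point global_ring (x, y)"
    using assms by (auto simp: proj_point_def intro!: exI[of _ "b * c"])
next
  fix r assume "r \<in> proj_point global_ring (x, y)"
  then obtain b where "b \<noteq> 0" "r = ((b / c) * (c * x), (b / c) * (c * y))"
    using assms by (auto simp: proj_point_def)
  then show "r \<in> proj_point global_ring (c * x, c * y)"
    using assms unfolding proj_point_def by (intro CollectI exI[of _ "b / c"]) simp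
qed

section \<open>Scaling and embedding over the completion\<close>

context abs_value
begin

lemma completion_one_nonzero: "\<one>\<^bsub>K\<^sub>v\<^esub> \<in> carrier K\<^sub>v - {\<zero>\<^bsub>K\<^sub>v\<^esub>}"
proof -
  have "completion_abs v \<one>\<^bsub>K\<^sub>v\<^esub> = 1"
    unfolding seq_class_one by (rule completion_abs_unique) auto
  then show ?thesis
    using completion_abs_zero_iff[of "\<one>\<^bsub>K\<^sub>v\<^esub>"] by (auto simp: seq_class_one)
qed

lemma local_norm_pos:
  assumes "p \<in> affine_minus_origin K\<^sub>v"
  shows "0 < local_norm v p"
proof -
  have "fst p \<in> carrier K\<^sub>v" "snd p \<in> carrier K\<^sub>v" "fst p \<noteq> \<zero>\<^bsub>K\<^sub>v\<^esub> \<or> snd p \<noteq> \<zero>\<^bsub>K\<^sub>v\<^esub>"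
    using assms by (auto simp: affine_minus_origin_def)
  then show ?thesis
    using completion_abs_pos by (auto simp: local_norm_def less_max_iff_disj)
qed

lemma local_norm_scale:
  assumes "c \<in> carrier K\<^sub>v" "p \<in> carrier K\<^sub>v \<times> carrier K\<^sub>v"
  shows "local_norm v (c \<otimes>\<^bsub>K\<^sub>v\<^esub> fst p, c \<otimes>\<^bsub>K\<^sub>v\<^esub> snd p) = completion_abs v c * local_norm v p"
  using assms completion_abs_nonneg[of c] max_mult_distrib_left[of "completion_abs v c"]
  by (auto simp: local_norm_def completion_abs_mult)

lemma completion_mult_nonzero:
  assumes "c \<in> carrier K\<^sub>v - {\<zero>\<^bsub>K\<^sub>v\<^esub>}" "\<xi> \<in> carrier K\<^sub>v - {\<zero>\<^bsub>K\<^sub>v\<^esub>}"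
  shows "c \<otimes>\<^bsub>K\<^sub>v\<^esub> \<xi> \<in> carrier K\<^sub>v - {\<zero>\<^bsub>K\<^sub>v\<^esub>}"
proof -
  interpret cring K\<^sub>v
    by (rule completion_cring)
  have "completion_abs v c * completion_abs v \<xi> \<noteq> 0"
    using assms completion_abs_zero_iff by auto
  then have "completion_abs v (c \<otimes>\<^bsub>K\<^sub>v\<^esub> \<xi>) \<noteq> 0"
    using assms by (simp add: completion_abs_mult)
  then show ?thesis
    using assms completion_abs_zero_iff[of "c \<otimes>\<^bsub>K\<^sub>v\<^esub> \<xi>"] by auto
qed

lemma affine_scale:
  assumes "c \<in> carrier K\<^sub>v - {\<zero>\<^bsub>K\<^sub>v\<^esub>}" "p \<in> affine_minus_origin K\<^sub>v"
  shows "(c \<otimes>\<^bsub>K\<^sub>v\<^esub> fst p, c \<otimes>\<^bsub>K\<^sub>v\<^esub> snd p) \<in> affine_minus_origin K\<^sub>v"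
proof -
  interpret cring K\<^sub>v
    by (rule completion_cring)
  have c: "c \<in> carrier K\<^sub>v"
    using assms(1) by simp
  obtain \<xi> \<eta> where p: "p = (\<xi>, \<eta>)" "\<xi> \<in> carrier K\<^sub>v" "\<eta> \<in> carrier K\<^sub>v"
      "\<xi> \<noteq> \<zero>\<^bsub>K\<^sub>v\<^esub> \<or> \<eta> \<noteq> \<zero>\<^bsub>K\<^sub>v\<^esub>"
    using assms(2) by (auto simp: affine_minus_origin_def)
  then have "c \<otimes>\<^bsub>K\<^sub>v\<^esub> \<xi> \<noteq> \<zero>\<^bsub>K\<^sub>v\<^esub> \<or> c \<otimes>\<^bsub>K\<^sub>v\<^esub> \<eta> \<noteq> \<zero>\<^bsub>K\<^sub>v\<^esub>"
    using completion_mult_nonzero[OF assms(1)] by blast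
  then show ?thesis
    using c p(2,3) by (simp add: affine_minus_origin_def p(1))
qed

lemma coords_affine:
  assumes "P \<in> proj_line K\<^sub>v"
  shows "coords P \<in> affine_minus_origin K\<^sub>v"
proof -
  obtain p where p: "p \<in> affine_minus_origin K\<^sub>v" "P = proj_point K\<^sub>v p"
    using assms by (auto simp: proj_line_def)
  obtain c where "c \<in> carrier K\<^sub>v - {\<zero>\<^bsub>K\<^sub>v\<^esub>}" "coords P = (c \<otimes>\<^bsub>K\<^sub>v\<^esub> fst p, c \<otimes>\<^bsub>K\<^sub>v\<^esub> snd p)"
    using coords_proj_point[OF completion_one_nonzero] p(2) by metis
  then show ?thesis
    using affine_scale p(1) by simp
qed

abbreviation embed2 :: "'a \<times> 'a \<Rightarrow> (nat \<Rightarrow> 'a) set \<times> (nat \<Rightarrow> 'a) set" where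
  "embed2 \<equiv> map_prod (completion_embed v) (completion_embed v)"

lemma local_norm_embed: "local_norm v (embed2 q) = max (v (fst q)) (v (snd q))"
  by (simp add: local_norm_def)

lemma embed_affine:
  assumes "q \<noteq> (0, 0)"
  shows "embed2 q \<in> affine_minus_origin K\<^sub>v"
proof -
  have "completion_embed v c = \<zero>\<^bsub>K\<^sub>v\<^esub> \<longleftrightarrow> c = 0" for c
    using completion_abs_zero_iff[of "completion_embed v c"] by simp
  then show ?thesis
    using assms by (cases q) (auto simp: affine_minus_origin_def)
qed

lemma lift_map_embed:
  "lift_map K\<^sub>v (completion_embed v) L (embed2 q) = embed2 (lift_map global_ring id L q)"
  by (cases q) (simp add: lift_map_def bieval_embed)

lemma completion_abs_power:
  assumes "c \<in> carrier K\<^sub>v"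
  shows "c [^]\<^bsub>K\<^sub>v\<^esub> k \<in> carrier K\<^sub>v" "completion_abs v (c [^]\<^bsub>K\<^sub>v\<^esub> k) = completion_abs v c ^ (k::nat)"
proof -
  interpret cring K\<^sub>v
    by (rule completion_cring)
  show closed: "c [^]\<^bsub>K\<^sub>v\<^esub> k \<in> carrier K\<^sub>v" for k :: nat
    using assms by simp
  show "completion_abs v (c [^]\<^bsub>K\<^sub>v\<^esub> k) = completion_abs v c ^ k"
  proof (induction k)
    case 0
    have "completion_abs v \<one>\<^bsub>K\<^sub>v\<^esub> = 1"
      unfolding seq_class_one by (rule completion_abs_unique) auto
    then show ?case
      by simp
  next
    case (Suc k)
    then show ?case
      using assms closed by (simp add: completion_abs_mult)
  qed
qed

lemma lift_map_scale:
  assumes "homogeneous d (fst L)" "homogeneous d (snd L)" "c \<in> carrier K\<^sub>v"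
    "p \<in> carrier K\<^sub>v \<times> carrier K\<^sub>v"
  defines "q \<equiv> lift_map K\<^sub>v (completion_embed v) L p"
  shows "lift_map K\<^sub>v (completion_embed v) L (c \<otimes>\<^bsub>K\<^sub>v\<^esub> fst p, c \<otimes>\<^bsub>K\<^sub>v\<^esub> snd p)
    = (c [^]\<^bsub>K\<^sub>v\<^esub> d \<otimes>\<^bsub>K\<^sub>v\<^esub> fst q, c [^]\<^bsub>K\<^sub>v\<^esub> d \<otimes>\<^bsub>K\<^sub>v\<^esub> snd q)"
  using assms(3,4) bieval_completion_scale[OF assms(1), of c "fst p" "snd p"]
    bieval_completion_scale[OF assms(2), of c "fst p" "snd p"]
  by (auto simp: q_def lift_map_def)

end

section \<open>Random orbits and their Green functions\<close>

locale random_dynamics =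
  fixes F :: "'a::field set" and S :: "'a proj_map set" and \<nu>\<^sub>1 :: "'a proj_map measure"
    and lft :: "'a proj_map \<Rightarrow> 'a bipoly \<times> 'a bipoly"
  assumes product_formula: "product_formula F"
    and finite_S: "finite S"
    and degree_ge_2: "\<And>\<phi>. \<phi> \<in> S \<Longrightarrow> 2 \<le> endo_degree \<phi>"
    and prob_space: "prob_space \<nu>\<^sub>1"
    and space: "space \<nu>\<^sub>1 = S"
    and sets: "sets \<nu>\<^sub>1 = Pow S"
    and is_lift: "\<And>\<phi>. \<phi> \<in> S \<Longrightarrow> is_lift (endo_degree \<phi>) (lft \<phi>) \<phi>"
begin

abbreviation M where "M \<equiv> sequence_measure \<nu>\<^sub>1"

sublocale prob_space M
  using prob_space by (rule prob_space_sequence_measure)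

abbreviation orbit where
  "orbit \<gamma> \<equiv> compose_upto (\<lambda>i. lift_map global_ring id (lft (\<gamma> i)))"

abbreviation local_orbit where
  "local_orbit v \<gamma> \<equiv> compose_upto (\<lambda>i. lift_map (completion_ring v) (completion_embed v) (lft (\<gamma> i)))"

lemma lift_D:
  assumes "\<phi> \<in> S"
  shows "homogeneous (endo_degree \<phi>) (fst (lft \<phi>))" "homogeneous (endo_degree \<phi>) (snd (lft \<phi>))"
    "coprime (fst (lft \<phi>)) (snd (lft \<phi>))"
    "\<And>p. p \<noteq> (0, 0) \<Longrightarrow> \<phi> (proj_point global_ring p)
       = proj_point global_ring (lift_map global_ring id (lft \<phi>) p)"
  using is_lift[OF assms] by (auto simp: is_lift_def affine_minus_origin_def)

lemma lift_nonzero: "\<phi> \<in> S \<Longrightarrow> p \<noteq> (0, 0) \<Longrightarrow> lift_map global_ring id (lft \<phi>) p \<noteq> (0, 0)"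
  using coprime_forms_no_common_zero[OF lift_D(1-3)] by (cases p) (auto simp: lift_map_def)

text \<open>The product is indexed from 1, so the entry at 0 carries no information and only
  successors are addressed.\<close>

lemma sequence_in: "\<gamma> \<in> space M \<Longrightarrow> \<gamma> (Suc i) \<in> S"
  by (auto simp: sequence_measure_def space_PiM space)

definition lift_bound :: "'a proj_map \<Rightarrow> ('a \<Rightarrow> real) \<Rightarrow> real \<Rightarrow> bool" where
  "lift_bound \<phi> v C \<longleftrightarrow> (\<forall>x y. (x, y) \<noteq> (0, 0) \<longrightarrow>
     exp (- C) * max (v x) (v y) ^ endo_degree \<phi>
       \<le> max (v (bieval global_ring id (fst (lft \<phi>)) (x, y))) (v (bieval global_ring id (snd (lft \<phi>)) (x, y))) \<and>
     max (v (bieval global_ring id (fst (lft \<phi>)) (x, y))) (v (bieval global_ring id (snd (lft \<phi>)) (x, y)))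
       \<le> exp C * max (v x) (v y) ^ endo_degree \<phi>)"

lemma lift_bound_mono:
  assumes "v \<in> places F" "lift_bound \<phi> v C" "C \<le> C'"
  shows "lift_bound \<phi> v C'"
  unfolding lift_bound_def
proof (intro allI impI)
  interpret abs_value v
    using assms(1) by (rule places_abs_value)
  fix x y :: 'a assume xy: "(x, y) \<noteq> (0, 0)"
  let ?m = "max (v x) (v y) ^ endo_degree \<phi>"
  let ?n = "max (v (bieval global_ring id (fst (lft \<phi>)) (x, y))) (v (bieval global_ring id (snd (lft \<phi>)) (x, y)))"
  have "0 \<le> ?m"
    by (simp add: max.coboundedI1)
  then have "exp (- C') * ?m \<le> exp (- C) * ?m" "exp C * ?m \<le> exp C' * ?m"
    using assms(3) by (auto intro!: mult_right_mono)
  moreover have "exp (- C) * ?m \<le> ?n \<and> ?n \<le> exp C * ?m"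
    using assms(2) xy unfolding lift_bound_def by blast
  ultimately show "exp (- C') * ?m \<le> ?n \<and> ?n \<le> exp C' * ?m"
    by linarith
qed

lemma ex_lift_bound:
  assumes "\<phi> \<in> S"
  shows "\<exists>C. adelic F C \<and> (\<forall>v\<in>places F. lift_bound \<phi> v (C v))"
  unfolding lift_bound_def by (rule adelic_lift_bound[OF product_formula lift_D(1-3)[OF assms]]) blast

text \<open>Chosen once for the whole of S, so that estimates along an orbit depend on the place and
  the lifts but not on \<gamma>.\<close>

definition bnd where
  "bnd = (SOME C. adelic F C \<and> (\<forall>\<phi>\<in>S. \<forall>v\<in>places F. lift_bound \<phi> v (C v)))"

lemma bnd: "adelic F bnd \<and> (\<forall>\<phi>\<in>S. \<forall>v\<in>places F. lift_bound \<phi> v (bnd v))"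
proof -
  have "\<exists>C. \<forall>\<phi>\<in>S. adelic F (C \<phi>) \<and> (\<forall>v\<in>places F. lift_bound \<phi> v (C \<phi> v))"
    using ex_lift_bound by (intro bchoice ballI)
  then obtain C where C: "\<And>\<phi>. \<phi> \<in> S \<Longrightarrow> adelic F (C \<phi>)"
    "\<And>\<phi> v. \<phi> \<in> S \<Longrightarrow> v \<in> places F \<Longrightarrow> lift_bound \<phi> v (C \<phi> v)"
    by blast
  \<comment> \<open>S is finite: adding the constants of its members keeps summability over the
    places and, by nonnegativity, dominates each of them.\<close>
  have "lift_bound \<phi> v (\<Sum>\<phi>\<in>S. C \<phi> v)" if "\<phi> \<in> S" "v \<in> places F" for \<phi> v
  proof (rule lift_bound_mono[OF that(2) C(2)[OF that]])
    show "C \<phi> v \<le> (\<Sum>\<phi>\<in>S. C \<phi> v)"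
      using that(1) _ finite_S by (rule member_le_sum) (rule adelic_nonneg[OF C(1) that(2)], simp)
  qed
  moreover have "adelic F (\<lambda>v. \<Sum>\<phi>\<in>S. C \<phi> v)"
    using finite_S C(1) by (rule adelic_sum)
  ultimately have "\<exists>C. adelic F C \<and> (\<forall>\<phi>\<in>S. \<forall>v\<in>places F. lift_bound \<phi> v (C v))"
    by (intro exI[of _ "\<lambda>v. \<Sum>\<phi>\<in>S. C \<phi> v"]) blast
  then show ?thesis
    unfolding bnd_def by (rule someI_ex)
qed

lemma adelic_bnd: "adelic F bnd"
  using bnd by blast

lemma local_lift_bound:
  assumes "v \<in> places F" "\<phi> \<in> S" "p \<in> carrier (completion_ring v) \<times> carrier (completion_ring v)"
  shows "exp (- bnd v) * local_norm v p ^ endo_degree \<phi>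
      \<le> local_norm v (lift_map (completion_ring v) (completion_embed v) (lft \<phi>) p)"
    and "local_norm v (lift_map (completion_ring v) (completion_embed v) (lft \<phi>) p)
      \<le> exp (bnd v) * local_norm v p ^ endo_degree \<phi>"
proof -
  interpret abs_value v
    using assms(1) by (rule places_abs_value)
  have "0 < endo_degree \<phi>"
    using degree_ge_2[OF assms(2)] by simp
  note * = lift_map_bound[OF lift_D(1,2)[OF assms(2)] this _ _ assms(3), of "exp (- bnd v)" "exp (bnd v)"]
  have "lift_bound \<phi> v (bnd v)"
    using bnd assms(1,2) by blast
  then show "exp (- bnd v) * local_norm v p ^ endo_degree \<phi>
      \<le> local_norm v (lift_map (completion_ring v) (completion_embed v) (lft \<phi>) p)"
    and "local_norm v (lift_map (completion_ring v) (completion_embed v) (lft \<phi>) p)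
      \<le> exp (bnd v) * local_norm v p ^ endo_degree \<phi>"
    unfolding lift_bound_def by (intro *; blast)+
qed

lemma local_orbit_closed:
  assumes "v \<in> places F" "p \<in> carrier (completion_ring v) \<times> carrier (completion_ring v)"
  shows "local_orbit v \<gamma> n p \<in> carrier (completion_ring v) \<times> carrier (completion_ring v)"
proof -
  interpret abs_value v
    using assms(1) by (rule places_abs_value)
  show ?thesis
    using assms(2) by (induction n) (auto simp: lift_map_def mem_Times_iff bieval_closed)
qed

text \<open>Degrees multiply under composition, so the composed lift is homogeneous of degree
  \<open>iter_degree \<gamma> n\<close>.\<close>

lemma local_orbit_scale:
  assumes "v \<in> places F" "\<gamma> \<in> space M" "c \<in> carrier (completion_ring v)"
    "p \<in> carrier (completion_ring v) \<times> carrier (completion_ring v)"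
  shows "local_norm v (local_orbit v \<gamma> n (c \<otimes>\<^bsub>completion_ring v\<^esub> fst p, c \<otimes>\<^bsub>completion_ring v\<^esub> snd p))
    = completion_abs v c ^ iter_degree \<gamma> n * local_norm v (local_orbit v \<gamma> n p)"
proof -
  interpret abs_value v
    using assms(1) by (rule places_abs_value)
  interpret K: cring K\<^sub>v
    by (rule completion_cring)
  have "local_orbit v \<gamma> n (c \<otimes>\<^bsub>K\<^sub>v\<^esub> fst p, c \<otimes>\<^bsub>K\<^sub>v\<^esub> snd p)
    = (c [^]\<^bsub>K\<^sub>v\<^esub> iter_degree \<gamma> n \<otimes>\<^bsub>K\<^sub>v\<^esub> fst (local_orbit v \<gamma> n p),
       c [^]\<^bsub>K\<^sub>v\<^esub> iter_degree \<gamma> n \<otimes>\<^bsub>K\<^sub>v\<^esub> snd (local_orbit v \<gamma> n p))"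
  proof (induction n)
    case 0
    then show ?case
      using assms(3) by (simp add: iter_degree_def)
  next
    case (Suc n)
    have "(c [^]\<^bsub>K\<^sub>v\<^esub> iter_degree \<gamma> n) [^]\<^bsub>K\<^sub>v\<^esub> endo_degree (\<gamma> (Suc n))
        = c [^]\<^bsub>K\<^sub>v\<^esub> iter_degree \<gamma> (Suc n)"
      using assms(3) by (simp add: K.nat_pow_pow iter_degree_def mult.commute)
    then show ?case
      using lift_map_scale[OF lift_D(1,2)[OF sequence_in[OF assms(2), of n]]
          completion_abs_power(1)[OF assms(3)] local_orbit_closed[OF assms(1,4)],
          of "iter_degree \<gamma> n" \<gamma> n]
      by (simp add: Suc)
  qed
  then show ?thesis
    using local_norm_scale[of "c [^]\<^bsub>K\<^sub>v\<^esub> iter_degree \<gamma> n" "local_orbit v \<gamma> n p"]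
      assms(3) local_orbit_closed[OF assms(1,4)]
    by (simp add: completion_abs_power)
qed

lemma iter_degree_pos: "\<gamma> \<in> space M \<Longrightarrow> 0 < iter_degree \<gamma> n"
proof -
  assume \<gamma>: "\<gamma> \<in> space M"
  have "0 < endo_degree (\<gamma> i)" if "i \<in> {1..n}" for i
    using degree_ge_2[OF sequence_in[OF \<gamma>, of "i - 1"]] that by simp
  then show ?thesis
    by (simp add: iter_degree_def)
qed

text \<open>The error estimate has two uses: at n = 0 it bounds the Green function in terms of the
  norm of p, and for general n it compares it with the heights along the orbit.\<close>

lemma green_approx:
  assumes v: "v \<in> places F" and \<gamma>: "\<gamma> \<in> space M" and p: "p \<in> affine_minus_origin (completion_ring v)"
  shows "0 < local_norm v (local_orbit v \<gamma> n p)"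
    and "(\<lambda>n. ln (local_norm v (local_orbit v \<gamma> n p)) / real (iter_degree \<gamma> n)) \<longlonglongrightarrow> green v lft \<gamma> p"
    and "\<bar>green v lft \<gamma> p - ln (local_norm v (local_orbit v \<gamma> n p)) / real (iter_degree \<gamma> n)\<bar>
      \<le> bnd v / 2 ^ n"
proof -
  interpret abs_value v
    using v by (rule places_abs_value)
  have closed: "local_orbit v \<gamma> n p \<in> carrier K\<^sub>v \<times> carrier K\<^sub>v" for n
    using v p by (intro local_orbit_closed) (auto simp: affine_minus_origin_def)
  note * = escape_rate[of "bnd v" "\<lambda>n. local_norm v (local_orbit v \<gamma> n p)" "\<lambda>i. endo_degree (\<gamma> i)",
      OF adelic_nonneg[OF adelic_bnd v] _ degree_ge_2[OF sequence_in[OF \<gamma>]]]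
  have 0: "0 < local_norm v (local_orbit v \<gamma> 0 p)"
    using local_norm_pos[OF p] by simp
  have lower: "exp (- bnd v) * local_norm v (local_orbit v \<gamma> n p) ^ endo_degree (\<gamma> (Suc n))
      \<le> local_norm v (local_orbit v \<gamma> (Suc n) p)" for n
    using local_lift_bound(1)[OF v sequence_in[OF \<gamma>] closed] by simp
  have upper: "local_norm v (local_orbit v \<gamma> (Suc n) p)
      \<le> exp (bnd v) * local_norm v (local_orbit v \<gamma> n p) ^ endo_degree (\<gamma> (Suc n))" for n
    using local_lift_bound(2)[OF v sequence_in[OF \<gamma>] closed] by simp
  show "0 < local_norm v (local_orbit v \<gamma> n p)"
    by (rule *(1)[OF 0 lower upper])
  show "(\<lambda>n. ln (local_norm v (local_orbit v \<gamma> n p)) / real (iter_degree \<gamma> n)) \<longlonglongrightarrow> green v lft \<gamma> p"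
    unfolding green_def iter_degree_def by (rule *(2)[OF 0 lower upper])
  show "\<bar>green v lft \<gamma> p - ln (local_norm v (local_orbit v \<gamma> n p)) / real (iter_degree \<gamma> n)\<bar>
      \<le> bnd v / 2 ^ n"
    unfolding green_def iter_degree_def by (rule *(3)[OF 0 lower upper])
qed

text \<open>Each approximant already changes by exactly ln |c|: the composed lift multiplies the
  norm by |c|^\<open>iter_degree\<close>, and the normalization divides by the same degree.\<close>

lemma green_scale:
  assumes v: "v \<in> places F" and \<gamma>: "\<gamma> \<in> space M"
    and c: "c \<in> carrier (completion_ring v) - {\<zero>\<^bsub>completion_ring v\<^esub>}"
    and p: "p \<in> affine_minus_origin (completion_ring v)"
  shows "green v lft \<gamma> (c \<otimes>\<^bsub>completion_ring v\<^esub> fst p, c \<otimes>\<^bsub>completion_ring v\<^esub> snd p)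
    = ln (completion_abs v c) + green v lft \<gamma> p"
proof (rule LIMSEQ_unique)
  interpret abs_value v
    using v by (rule places_abs_value)
  let ?a = "\<lambda>p n. ln (local_norm v (local_orbit v \<gamma> n p)) / real (iter_degree \<gamma> n)"
  let ?cp = "(c \<otimes>\<^bsub>K\<^sub>v\<^esub> fst p, c \<otimes>\<^bsub>K\<^sub>v\<^esub> snd p)"
  show "?a ?cp \<longlonglongrightarrow> green v lft \<gamma> ?cp"
    using green_approx(2)[OF v \<gamma> affine_scale[OF c p]] .
  have "?a ?cp n = ln (completion_abs v c) + ?a p n" for n
  proof -
    have "0 < completion_abs v c" "0 < local_norm v (local_orbit v \<gamma> n p)" "0 < iter_degree \<gamma> n"
      using c completion_abs_pos green_approx(1)[OF v \<gamma> p] iter_degree_pos[OF \<gamma>] by auto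
    moreover have "local_norm v (local_orbit v \<gamma> n ?cp)
        = completion_abs v c ^ iter_degree \<gamma> n * local_norm v (local_orbit v \<gamma> n p)"
      using c p by (intro local_orbit_scale v \<gamma>) (auto simp: affine_minus_origin_def)
    ultimately show ?thesis
      by (simp add: ln_mult ln_realpow add_divide_distrib)
  qed
  then show "?a ?cp \<longlonglongrightarrow> ln (completion_abs v c) + green v lft \<gamma> p"
    using tendsto_add[OF tendsto_const green_approx(2)[OF v \<gamma> p]] by presburger
qed

section \<open>Measurability and integrability in the random sequence\<close>

lemma measurable_finite_sequence:
  fixes h :: "(nat \<Rightarrow> 'a proj_map) \<Rightarrow> real"
  assumes "\<And>\<gamma> \<gamma>'. (\<And>i. i \<in> {1..n} \<Longrightarrow> \<gamma> i = \<gamma>' i) \<Longrightarrow> h \<gamma> = h \<gamma>'"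
  shows "h \<in> borel_measurable M"
  by (rule measurable_sequence_measure_finite[OF _ _ assms]) (use finite_S in \<open>auto simp: space sets\<close>)

lemma iter_degree_cong:
  "(\<And>i. i \<in> {1..n} \<Longrightarrow> \<gamma> i = \<gamma>' i) \<Longrightarrow> iter_degree \<gamma> n = iter_degree \<gamma>' n"
  unfolding iter_degree_def by (rule prod.cong) auto

text \<open>The n-th approximant sees only the first n maps, and a pointwise \<open>lim\<close> of
  measurable functions is measurable whether or not it converges; so v and p are arbitrary.\<close>

lemma measurable_green: "(\<lambda>\<gamma>. green v lft \<gamma> p) \<in> borel_measurable M"
  unfolding green_def
proof (rule borel_measurable_lim_metric, rule measurable_finite_sequence)
  fix n and \<gamma> \<gamma>' :: "nat \<Rightarrow> 'a proj_map"
  assume *: "\<And>i. i \<in> {1..n} \<Longrightarrow> \<gamma> i = \<gamma>' i"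
  then have "local_orbit v \<gamma> n = local_orbit v \<gamma>' n"
    by (intro compose_upto_cong) simp
  then show "ln (local_norm v (local_orbit v \<gamma> n p)) / real (iter_degree \<gamma> n)
      = ln (local_norm v (local_orbit v \<gamma>' n p)) / real (iter_degree \<gamma>' n)"
    using iter_degree_cong[OF *] by presburger
qed

lemma measurable_canonical_height: "(\<lambda>\<gamma>. canonical_height F \<gamma> P) \<in> borel_measurable M"
  unfolding canonical_height_def
proof (rule borel_measurable_lim_metric, rule measurable_finite_sequence)
  fix n and \<gamma> \<gamma>' :: "nat \<Rightarrow> 'a proj_map"
  assume *: "\<And>i. i \<in> {1..n} \<Longrightarrow> \<gamma> i = \<gamma>' i"
  then have "compose_upto \<gamma> n = compose_upto \<gamma>' n"
    by (rule compose_upto_cong)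
  then show "weil_height F (compose_upto \<gamma> n P) / real (iter_degree \<gamma> n)
      = weil_height F (compose_upto \<gamma>' n P) / real (iter_degree \<gamma>' n)"
    using iter_degree_cong[OF *] by presburger
qed

lemma green_bound:
  assumes "v \<in> places F" "\<gamma> \<in> space M" "p \<in> affine_minus_origin (completion_ring v)"
  shows "\<bar>green v lft \<gamma> p\<bar> \<le> \<bar>ln (local_norm v p)\<bar> + bnd v"
  using green_approx(3)[OF assms, of 0] by (simp add: iter_degree_def)

lemma integrable_green:
  assumes "v \<in> places F" "p \<in> affine_minus_origin (completion_ring v)"
  shows "integrable M (\<lambda>\<gamma>. green v lft \<gamma> p)"
  using assms measurable_green green_bound
  by (intro integrable_const_bound[of _ "\<bar>ln (local_norm v p)\<bar> + bnd v"]) auto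

text \<open>The logarithm of E is constant in \<gamma>, and the Green function is bounded in
  \<gamma> on a probability space.\<close>

lemma integrable_local_height:
  assumes "v \<in> places F" "P \<in> proj_line (completion_ring v)"
  shows "integrable M (\<lambda>\<gamma>. local_height v lft \<gamma> E P)"
proof -
  interpret abs_value v
    using assms(1) by (rule places_abs_value)
  show ?thesis
    unfolding local_height_def
    using integrable_green[OF assms(1) coords_affine[OF assms(2)]] by simp
qed

section \<open>The canonical height as a sum of Green functions\<close>

lemma weil_height_has_sum:
  assumes "q \<noteq> (0, 0)"
  shows "((\<lambda>v. local_degree F v * ln (max (v (fst q)) (v (snd q))))
    has_sum weil_height F (proj_point global_ring q)) (places F)"
proof -
  have "(\<lambda>v. local_degree F v * ln (max (v (fst q)) (v (snd q)))) summable_on places F"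
    by (rule adelic_summable[OF adelic_add[OF adelic_ln[OF product_formula] adelic_ln[OF product_formula]]
        abs_ln_max_le])
  then have sum: "((\<lambda>v. local_degree F v * ln (max (v (fst q)) (v (snd q)))) has_sum
      (\<Sum>\<^sub>\<infinity>v\<in>places F. local_degree F v * ln (max (v (fst q)) (v (snd q))))) (places F)"
    by (rule has_sum_infsum)
  obtain c where c: "c \<noteq> 0" "coords (proj_point global_ring q) = (c * fst q, c * snd q)"
    using coords_proj_point[of "global_ring :: 'a ring" q] by auto
  \<comment> \<open>The chosen coordinates are c times q. Adding the product formula for c leaves
    the total unchanged and turns the terms for q into those for the chosen coordinates.\<close>
  have add: "((\<lambda>v. local_degree F v * ln (v c) + local_degree F v * ln (max (v (fst q)) (v (snd q))))
      has_sum (0 + (\<Sum>\<^sub>\<infinity>v\<in>places F. local_degree F v * ln (max (v (fst q)) (v (snd q)))))) (places F)"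
    using product_formula c(1) unfolding product_formula_def by (intro has_sum_add sum) auto
  have eq: "local_degree F v * ln (v c) + local_degree F v * ln (max (v (fst q)) (v (snd q)))
      = local_degree F v * ln (max (v (c * fst q)) (v (c * snd q)))" if "v \<in> places F" for v
  proof -
    interpret abs_value v
      using that by (rule places_abs_value)
    have "0 < max (v (fst q)) (v (snd q))"
      using assms by (cases q) (auto simp: less_max_iff_disj)
    moreover have "max (v (c * fst q)) (v (c * snd q)) = v c * max (v (fst q)) (v (snd q))"
      using max_mult_distrib_left[of "v c" "v (fst q)" "v (snd q)"] by (simp add: mult)
    ultimately show ?thesis
      using c(1) by (simp add: ln_mult distrib_left)
  qed
  have "((\<lambda>v. local_degree F v * ln (max (v (c * fst q)) (v (c * snd q))))
      has_sum (\<Sum>\<^sub>\<infinity>v\<in>places F. local_degree F v * ln (max (v (fst q)) (v (snd q))))) (places F)"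
    using has_sum_cong[OF eq, THEN iffD1, OF _ add] by simp
  then have "weil_height F (proj_point global_ring q)
      = (\<Sum>\<^sub>\<infinity>v\<in>places F. local_degree F v * ln (max (v (fst q)) (v (snd q))))"
    unfolding weil_height_def c(2) by (simp add: infsumI)
  then show ?thesis
    using sum by simp
qed

lemma compose_upto_proj_point:
  assumes "\<gamma> \<in> space M" "q \<noteq> (0, 0)"
  shows "orbit \<gamma> n q \<noteq> (0, 0)"
    and "compose_upto \<gamma> n (proj_point global_ring q) = proj_point global_ring (orbit \<gamma> n q)"
proof -
  show nonzero: "orbit \<gamma> n q \<noteq> (0, 0)" for n
    using assms(2) by (induction n) (simp_all add: lift_nonzero[OF sequence_in[OF assms(1)]])
  show "compose_upto \<gamma> n (proj_point global_ring q) = proj_point global_ring (orbit \<gamma> n q)"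
  proof (induction n)
    case (Suc n)
    show ?case
      by (simp only: compose_upto.simps comp_apply Suc lift_D(4)[OF sequence_in[OF assms(1)] nonzero])
  qed simp
qed

lemma local_norm_orbit:
  assumes "v \<in> places F"
  shows "local_norm v (local_orbit v \<gamma> n (map_prod (completion_embed v) (completion_embed v) q))
    = max (v (fst (orbit \<gamma> n q))) (v (snd (orbit \<gamma> n q)))"
proof -
  interpret abs_value v
    using assms by (rule places_abs_value)
  have "local_orbit v \<gamma> n (embed2 q) = embed2 (orbit \<gamma> n q)"
  proof (induction n)
    case (Suc n)
    show ?case
      by (simp only: compose_upto.simps comp_apply Suc lift_map_embed)
  qed simp
  then show ?thesis
    by (simp add: local_norm_embed)
qed

abbreviation global_green where
  "global_green v \<gamma> q \<equiv> green v lft \<gamma> (map_prod (completion_embed v) (completion_embed v) q)"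

lemma global_green_bound:
  assumes "v \<in> places F" "\<gamma> \<in> space M" "q \<noteq> (0, 0)"
  shows "\<bar>global_green v \<gamma> q\<bar> \<le> (\<bar>ln (v (fst q))\<bar> + \<bar>ln (v (snd q))\<bar>) + bnd v"
proof -
  interpret abs_value v
    using assms(1) by (rule places_abs_value)
  show ?thesis
    using green_bound[OF assms(1,2) embed_affine[OF assms(3)]]
      abs_ln_max_le[of "v (fst q)" "v (snd q)"]
    unfolding local_norm_embed by linarith
qed

lemma adelic_green_bound: "adelic F (\<lambda>v. (\<bar>ln (v a)\<bar> + \<bar>ln (v b)\<bar>) + bnd v)"
  by (intro adelic_add adelic_ln product_formula adelic_bnd)

lemma canonical_height_has_sum:
  assumes \<gamma>: "\<gamma> \<in> space M" and q: "q \<noteq> (0, 0)"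
  shows "((\<lambda>v. local_degree F v * global_green v \<gamma> q)
    has_sum canonical_height F \<gamma> (proj_point global_ring q)) (places F)"
proof -
  define H where "H = (\<Sum>\<^sub>\<infinity>v\<in>places F. local_degree F v * global_green v \<gamma> q)"
  define B where "B = (\<Sum>\<^sub>\<infinity>v\<in>places F. local_degree F v * bnd v)"
  define h where "h n = weil_height F (compose_upto \<gamma> n (proj_point global_ring q)) / real (iter_degree \<gamma> n)" for n
  have H: "((\<lambda>v. local_degree F v * global_green v \<gamma> q) has_sum H) (places F)"
    unfolding H_def
    by (rule has_sum_infsum, rule adelic_summable[OF adelic_green_bound]) (rule global_green_bound[OF _ \<gamma> q])
  have B: "((\<lambda>v. local_degree F v * bnd v) has_sum B) (places F)"
    unfolding B_def using adelic_bnd by (intro has_sum_infsum) (simp add: adelic_def)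
  \<comment> \<open>Limit and sum over the places are exchanged by an explicit rate: the error at v
    is at most C_v / 2^n, so the total error is at most B / 2^n.\<close>
  have "norm (h n - H) \<le> B * (1 / 2 ^ n)" for n
  proof (rule norm_infsum_le)
    let ?a = "\<lambda>v. ln (max (v (fst (orbit \<gamma> n q))) (v (snd (orbit \<gamma> n q)))) / real (iter_degree \<gamma> n)"
    have "((\<lambda>v. local_degree F v * ln (max (v (fst (orbit \<gamma> n q))) (v (snd (orbit \<gamma> n q))))
        * (1 / real (iter_degree \<gamma> n))) has_sum
        weil_height F (proj_point global_ring (orbit \<gamma> n q)) * (1 / real (iter_degree \<gamma> n))) (places F)"
      by (intro has_sum_cmult_left weil_height_has_sum compose_upto_proj_point \<gamma> q)
    then have "((\<lambda>v. local_degree F v * ?a v) has_sum h n) (places F)"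
      by (simp add: h_def compose_upto_proj_point(2)[OF \<gamma> q])
    then show "((\<lambda>v. local_degree F v * ?a v - local_degree F v * global_green v \<gamma> q) has_sum (h n - H)) (places F)"
      using H by (rule has_sum_minus)
    show "((\<lambda>v. local_degree F v * bnd v * (1 / 2 ^ n)) has_sum B * (1 / 2 ^ n)) (places F)"
      by (intro has_sum_cmult_left B)
    fix v assume v: "v \<in> places F"
    interpret abs_value v
      using v by (rule places_abs_value)
    have "\<bar>?a v - global_green v \<gamma> q\<bar> \<le> bnd v / 2 ^ n"
      using green_approx(3)[OF v \<gamma> embed_affine[OF q], of n]
      unfolding local_norm_orbit[OF v] by (simp add: abs_minus_commute)
    then have "local_degree F v * \<bar>?a v - global_green v \<gamma> q\<bar> \<le> local_degree F v * (bnd v / 2 ^ n)"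
      by (rule mult_left_mono) simp
    then show "norm (local_degree F v * ?a v - local_degree F v * global_green v \<gamma> q)
        \<le> local_degree F v * bnd v * (1 / 2 ^ n)"
      by (simp only: right_diff_distrib[symmetric] real_norm_def abs_mult
          abs_of_nonneg[OF local_degree_nonneg]) simp
  qed
  moreover have "(\<lambda>n. B * (1 / 2 ^ n)) \<longlonglongrightarrow> 0"
    using tendsto_mult[OF tendsto_const LIMSEQ_power_zero[of "1 / 2 :: real"], of B]
    by (simp add: power_divide)
  ultimately have "(\<lambda>n. h n - H) \<longlonglongrightarrow> 0"
    by (intro Lim_null_comparison[of "\<lambda>n. h n - H" "\<lambda>n. B * (1 / 2 ^ n)"] always_eventually allI)
  then have "h \<longlonglongrightarrow> H"
    by (simp add: LIM_zero_iff)
  then have "canonical_height F \<gamma> (proj_point global_ring q) = H"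
    unfolding canonical_height_def h_def by (rule limI)
  then show ?thesis
    using H by simp
qed

section \<open>Expected heights\<close>

lemma expected_canonical_height_has_sum:
  assumes "q \<noteq> (0, 0)"
  shows "integrable M (\<lambda>\<gamma>. canonical_height F \<gamma> (proj_point global_ring q))"
    and "((\<lambda>v. local_degree F v * (\<integral>\<gamma>. global_green v \<gamma> q \<partial>M))
      has_sum expected_canonical_height F \<nu>\<^sub>1 (proj_point global_ring q)) (places F)"
proof -
  \<comment> \<open>This domination involves only the starting point and the common constants of S,
    hence is the same for all \<gamma>, as \<open>has_sum_integral\<close> requires.\<close>
  let ?B = "\<lambda>v. (\<bar>ln (v (fst q))\<bar> + \<bar>ln (v (snd q))\<bar>) + bnd v"
  have bound: "\<bar>local_degree F v * global_green v \<gamma> q\<bar> \<le> local_degree F v * ?B v"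
    if "v \<in> places F" "\<gamma> \<in> space M" for v \<gamma>
    using global_green_bound[OF that assms] by (simp add: abs_mult mult_left_mono)
  have B: "(\<lambda>v. local_degree F v * ?B v) summable_on places F"
    using adelic_green_bound by (simp add: adelic_def)
  have meas: "(\<lambda>\<gamma>. local_degree F v * global_green v \<gamma> q) \<in> borel_measurable M" for v
    using measurable_green by (intro borel_measurable_times) auto
  note * = has_sum_integral[OF meas bound B measurable_canonical_height canonical_height_has_sum[OF _ assms]]
  show "integrable M (\<lambda>\<gamma>. canonical_height F \<gamma> (proj_point global_ring q))"
    by (rule *(1))
  show "((\<lambda>v. local_degree F v * (\<integral>\<gamma>. global_green v \<gamma> q \<partial>M))
      has_sum expected_canonical_height F \<nu>\<^sub>1 (proj_point global_ring q)) (places F)"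
    using *(2) by (simp add: expected_canonical_height_def)
qed

text \<open>Moves from coordinates chosen over K_v to those chosen over K: only there is the value
  of E one element of K, the same at all places, to which the product formula can be
  applied.\<close>

lemma expected_local_height_global:
  assumes v: "v \<in> places F" and q: "coords P \<noteq> (0, 0)" and E: "homogeneous (total_degree E) E"
    and nz: "bieval global_ring id E (coords P) \<noteq> 0"
  shows "expected_local_height \<nu>\<^sub>1 v lft E (proj_embed v P)
    = real (total_degree E) * (\<integral>\<gamma>. global_green v \<gamma> (coords P) \<partial>M)
      - ln (v (bieval global_ring id E (coords P)))"
proof -
  interpret abs_value v
    using v by (rule places_abs_value)
  interpret K: cring K\<^sub>v
    by (rule completion_cring)
  let ?q = "embed2 (coords P)" and ?d = "total_degree E"
  obtain c where c: "c \<in> carrier K\<^sub>v - {\<zero>\<^bsub>K\<^sub>v\<^esub>}"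
      "coords (proj_embed v P) = (c \<otimes>\<^bsub>K\<^sub>v\<^esub> fst ?q, c \<otimes>\<^bsub>K\<^sub>v\<^esub> snd ?q)"
    unfolding proj_embed_def by (rule coords_proj_point[OF completion_one_nonzero])
  have embed: "bieval K\<^sub>v (completion_embed v) E ?q = completion_embed v (bieval global_ring id E (coords P))"
    using bieval_embed[of E "fst (coords P)" "snd (coords P)"] by (simp add: map_prod_def split_beta)
  have affine: "fst ?q \<in> carrier K\<^sub>v" "snd ?q \<in> carrier K\<^sub>v"
    by simp_all
  have "bieval K\<^sub>v (completion_embed v) E (coords (proj_embed v P))
      = c [^]\<^bsub>K\<^sub>v\<^esub> ?d \<otimes>\<^bsub>K\<^sub>v\<^esub> bieval K\<^sub>v (completion_embed v) E ?q"
    unfolding c(2) using bieval_completion_scale[OF E _ affine, of c] c(1)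
    by (simp del: fst_map_prod snd_map_prod)
  then have "completion_abs v (bieval K\<^sub>v (completion_embed v) E (coords (proj_embed v P)))
      = completion_abs v c ^ ?d * v (bieval global_ring id E (coords P))"
    using c(1) by (simp add: embed completion_abs_mult completion_abs_power)
  moreover have "0 < completion_abs v c"
    using c(1) completion_abs_pos by auto
  ultimately have ln: "ln (completion_abs v (bieval K\<^sub>v (completion_embed v) E (coords (proj_embed v P))))
      = real ?d * ln (completion_abs v c) + ln (v (bieval global_ring id E (coords P)))"
    using nz by (simp add: ln_mult ln_realpow)
  \<comment> \<open>\<open>green_scale\<close> and \<open>ln\<close> both contribute deg(E) log|c|,
    with opposite signs in the local height.\<close>
  have "local_height v lft \<gamma> E (proj_embed v P)
      = real ?d * global_green v \<gamma> (coords P) - ln (v (bieval global_ring id E (coords P)))"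
    if "\<gamma> \<in> space M" for \<gamma>
    unfolding local_height_def ln
    unfolding c(2) green_scale[OF v that c(1) embed_affine[OF q]]
    by (simp add: distrib_left)
  then have "expected_local_height \<nu>\<^sub>1 v lft E (proj_embed v P) = (\<integral>\<gamma>. real ?d * global_green v \<gamma> (coords P)
      - ln (v (bieval global_ring id E (coords P))) \<partial>M)"
    unfolding expected_local_height_def by (intro Bochner_Integration.integral_cong) auto
  also have "\<dots> = real ?d * (\<integral>\<gamma>. global_green v \<gamma> (coords P) \<partial>M)
      - ln (v (bieval global_ring id E (coords P)))"
    using integrable_green[OF v embed_affine[OF q]]
    by (subst Bochner_Integration.integral_diff) (auto simp: prob_space)
  finally show ?thesis .
qed

lemma expected_local_height_has_sum:
  assumes P: "P \<in> proj_line global_ring - zero_locus global_ring id E"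
    and E: "homogeneous (total_degree E) E"
  shows "integrable M (\<lambda>\<gamma>. canonical_height F \<gamma> P)"
    and "((\<lambda>v. local_degree F v * expected_local_height \<nu>\<^sub>1 v lft E (proj_embed v P))
      has_sum real (total_degree E) * expected_canonical_height F \<nu>\<^sub>1 P) (places F)"
proof -
  obtain p where p: "p \<noteq> (0, 0)" "P = proj_point global_ring p"
    using P by (auto simp: proj_line_def affine_minus_origin_def)
  obtain c where c: "c \<noteq> 0" "coords P = (c * fst p, c * snd p)"
    using coords_proj_point[of "global_ring :: 'a ring" p] p(2) by auto
  have q: "coords P \<noteq> (0, 0)"
    using p(1) c by (cases p) auto
  have P_eq: "P = proj_point global_ring (coords P)"
    using proj_point_scale[OF c(1), of "fst p" "snd p"] p(2) c(2) by simp
  \<comment> \<open>Lying outside the zero locus provides only some representative at which E is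
    nonzero; homogeneity transfers this to the chosen coordinates.\<close>
  obtain r where r: "r \<in> P" "bieval global_ring id E r \<noteq> 0"
    using P by (auto simp: zero_locus_def)
  then obtain b where "r = (b * fst (coords P), b * snd (coords P))"
    using P_eq by (auto simp: proj_point_def)
  then have nz: "bieval global_ring id E (coords P) \<noteq> 0"
    using r(2) bieval_homogeneous_scale[OF E, of b "fst (coords P)" "snd (coords P)"] by auto
  show "integrable M (\<lambda>\<gamma>. canonical_height F \<gamma> P)"
    using expected_canonical_height_has_sum(1)[OF q] P_eq by simp
  have "((\<lambda>v. local_degree F v * (\<integral>\<gamma>. global_green v \<gamma> (coords P) \<partial>M))
      has_sum expected_canonical_height F \<nu>\<^sub>1 P) (places F)"
    using expected_canonical_height_has_sum(2)[OF q] P_eq by simp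
  moreover have "((\<lambda>v. local_degree F v * ln (v (bieval global_ring id E (coords P)))) has_sum 0) (places F)"
    using product_formula nz by (simp add: product_formula_def)
  ultimately have diff: "((\<lambda>v. real (total_degree E) * (local_degree F v * (\<integral>\<gamma>. global_green v \<gamma> (coords P) \<partial>M))
      - local_degree F v * ln (v (bieval global_ring id E (coords P))))
      has_sum (real (total_degree E) * expected_canonical_height F \<nu>\<^sub>1 P - 0)) (places F)"
    by (intro has_sum_minus has_sum_cmult_right)
  have "real (total_degree E) * (local_degree F v * (\<integral>\<gamma>. global_green v \<gamma> (coords P) \<partial>M))
      - local_degree F v * ln (v (bieval global_ring id E (coords P)))
      = local_degree F v * expected_local_height \<nu>\<^sub>1 v lft E (proj_embed v P)"
    if "v \<in> places F" for v
    by (simp add: expected_local_height_global[OF that q E nz] right_diff_distrib mult.left_commute)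
  from has_sum_cong[OF this, THEN iffD1, OF _ diff]
  show "((\<lambda>v. local_degree F v * expected_local_height \<nu>\<^sub>1 v lft E (proj_embed v P))
      has_sum real (total_degree E) * expected_canonical_height F \<nu>\<^sub>1 P) (places F)"
    by simp
qed

end

theorem corollary4p5:
  fixes F :: "'a::field set"
    and E :: "'a bipoly"
    and S :: "'a proj_map set"
    and \<nu>\<^sub>1 :: "'a proj_map measure"
    and lft :: "'a proj_map \<Rightarrow> 'a bipoly \<times> 'a bipoly"
  assumes global_field: "global_field_over F"
    and product_formula: "product_formula F"
    and E: "E \<noteq> 0" "homogeneous (total_degree E) E" "total_degree E > 0"
    and S: "finite S" "\<forall>\<phi>\<in>S. endomorphism \<phi> \<and> endo_degree \<phi> \<ge> 2"
    and \<nu>\<^sub>1: "prob_space \<nu>\<^sub>1" "space \<nu>\<^sub>1 = S" "sets \<nu>\<^sub>1 = Pow S"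
    and lft: "\<forall>\<phi>\<in>S. is_lift (endo_degree \<phi>) (lft \<phi>) \<phi>"
  shows
    "(\<forall>v\<in>places F. \<forall>P\<in>proj_line (completion_ring v) - zero_locus (completion_ring v) (completion_embed v) E.
        integrable (sequence_measure \<nu>\<^sub>1) (\<lambda>\<gamma>. local_height v lft \<gamma> E P)) \<and>
     (\<forall>P\<in>proj_line global_ring - zero_locus global_ring id E.
        integrable (sequence_measure \<nu>\<^sub>1) (\<lambda>\<gamma>. canonical_height F \<gamma> P) \<and>
        (\<lambda>v. local_degree F v * expected_local_height \<nu>\<^sub>1 v lft E (proj_embed v P))
          summable_on places F \<and>
        expected_canonical_height F \<nu>\<^sub>1 P =
          1 / real (total_degree E) *
          (\<Sum>\<^sub>\<infinity>v\<in>places F.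
             local_degree F v * expected_local_height \<nu>\<^sub>1 v lft E (proj_embed v P)))"
proof -
  interpret random_dynamics F S \<nu>\<^sub>1 lft
  proof (rule random_dynamics.intro)
    show "\<And>\<phi>. \<phi> \<in> S \<Longrightarrow> 2 \<le> endo_degree \<phi>" "\<And>\<phi>. \<phi> \<in> S \<Longrightarrow> is_lift (endo_degree \<phi>) (lft \<phi>) \<phi>"
      using S(2) lft by blast+
  qed (fact product_formula S(1) \<nu>\<^sub>1)+
  show ?thesis
  proof (intro conjI ballI)
    fix v P
    assume "v \<in> places F"
      "P \<in> proj_line (completion_ring v) - zero_locus (completion_ring v) (completion_embed v) E"
    then show "integrable (sequence_measure \<nu>\<^sub>1) (\<lambda>\<gamma>. local_height v lft \<gamma> E P)"
      by (intro integrable_local_height) simp_all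
  next
    fix P :: "('a \<times> 'a) set"
    assume P: "P \<in> proj_line global_ring - zero_locus global_ring id E"
    note expected = expected_local_height_has_sum[OF P E(2)]
    show "integrable (sequence_measure \<nu>\<^sub>1) (\<lambda>\<gamma>. canonical_height F \<gamma> P)"
      by (rule expected(1))
    show "(\<lambda>v. local_degree F v * expected_local_height \<nu>\<^sub>1 v lft E (proj_embed v P))
        summable_on places F"
      using expected(2) by (rule has_sum_imp_summable)
    show "expected_canonical_height F \<nu>\<^sub>1 P = 1 / real (total_degree E) *
        (\<Sum>\<^sub>\<infinity>v\<in>places F. local_degree F v * expected_local_height \<nu>\<^sub>1 v lft E (proj_embed v P))"
      using E(3) by (simp add: infsumI[OF expected(2)])
  qed
qed

end
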